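(* Let $(x,u)\in\Gamma_\tau$, write $\mathfrak{D}=(x,u)$, and suppose that there exists a system $(A_s,B_s)\in\Sigma_{n,m}$ such that $x'(t)=A_sx(t)+B_su(t)$ for a.e. $t\in[0,\tau]$. Let $(X_{\mathrm d},X,U)$ be the synthesis operator triple associated with $(x,u)$. Then the following statements are equivalent: (i) The data $(x,u)$ are informative for stabilization. (ii) $\operatorname{Ran}X=\mathbb{R}^n$, and there exists a right inverse $S$ of $X$ such that the matrix $X_{\mathrm d}S\in\mathbb{R}^{n\times n}$ is Hurwitz. (iii) The matrix $XX^*\in\mathbb{R}^{n\times n}$ is invertible, and there exists a matrix $H\in\mathbb{R}^{n\times n}$ such that the matrix $F+GH$ is Hurwitz, where $F,G\in\mathbb{R}^{n\times n}$ are defined by $$F=X_{\mathrm d}X^*(XX^* )^{-1},\qquad G=X_{\mathrm d}X_{\mathrm d}^*-X_{\mathrm d}X^*(XX^* )^{-1}XX_{\mathrm d}^*.$$ Furthermore, if statement (iii) holds (with such a matrix $H$), then the feedback gain $$K=UX^*(XX^* )^{-1}+\bigl(UX_{\mathrm d}^*-UX^*(XX^* )^{-1}XX_{\mathrm d}^*\bigr)H$$ is such that $A+BK$ is Hurwitz for all $(A,B)\in\Sigma_{\mathfrak{D}}$.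
   Context: Fix $\tau>0$ and positive integers $n,m$. $\mathrm{L}^2([0,\tau];\mathbb{R}^n)$ is the space of (classes of) square-integrable measurable functions $[0,\tau]\to\mathbb{R}^n$; $\mathrm{H}^1([0,\tau];\mathbb{R}^n)$ is the space of absolutely continuous functions $\phi:[0,\tau]\to\mathbb{R}^n$ with $\phi'\in\mathrm{L}^2([0,\tau];\mathbb{R}^n)$; $\mathrm{H}^1_0[0,\tau]$ is the space of scalar functions $\phi\in \mathrm{H}^1([0,\tau];\mathbb{R})$ with $\phi(0)=\phi(\tau)=0$, a Hilbert space with inner product $\langle\phi,\psi\rangle_{\mathrm{H}^1_0}=\int_0^\tau\phi'(t)\psi'(t)\,dt$. $\Gamma_\tau=\{(x,u): x\in\mathrm{H}^1([0,\tau];\mathbb{R}^n),\ u\in\mathrm{L}^2([0,\tau];\mathbb{R}^m)\}$ and $\Sigma_{n,m}=\{(A,B):A\in\mathbb{R}^{n\times n},\ B\in\mathbb{R}^{n\times m}\}$. For $f\in\mathrm{L}^2([0,\tau];\mathbb{R}^k)$, the synthesis operator and the differentiated synthesis operator associated with $f$ are the bounded linear operators $\mathrm{H}^1_0[0,\tau]\to\mathbb{R}^k$ given by $\phi\mapsto\int_0^\tau\phi(t)f(t)\,dt$ and $\phi\mapsto-\int_0^\tau\phi'(t)f(t)\,dt$, respectively. For $(x,u)\in\Gamma_\tau$, the synthesis operator triple $(X_{\mathrm d},X,U)$ associated with $(x,u)$ consists of the differentiated synthesis operator $X_{\mathrm d}$ associated with $x$, the synthesis operator $X$ associated with $x$,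 and the synthesis operator $U$ associated with $u$. $T^*$ denotes the Hilbert space adjoint (with respect to $\langle\cdot,\cdot\rangle_{\mathrm{H}^1_0}$ and the Euclidean inner product); products such as $XX^*$, $UX_{\mathrm d}^*$, $X_{\mathrm d}S$ are linear maps between Euclidean spaces and are identified with matrices. $\operatorname{Ran}$ denotes the range. For Hilbert spaces $Y,Z$ and a bounded linear operator $T:Y\to Z$, a right inverse of $T$ is a bounded linear operator $S:Z\to Y$ with $TS=I$. A square matrix is Hurwitz if all its eigenvalues have negative real part. For $\mathfrak{D}=(x,u)\in\Gamma_\tau$, $\Sigma_{\mathfrak{D}}=\{(A,B)\in\Sigma_{n,m}: x'=Ax+Bu \text{ a.e. on }[0,\tau]\}$. The data $\mathfrak{D}=(x,u)$ are called informative for stabilization if there exists $K\in\mathbb{R}^{m\times n}$ such that $A+BK$ is Hurwitz for all $(A,B)\in\Sigma_{\mathfrak{D}}$. *)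

theory Defs
  imports "HOL-Analysis.Analysis"
begin

section \<open>Function spaces on \<open>[0, \<tau>]\<close>\<close>

text \<open>
  Elements of \<open>L\<^sup>2\<close> are represented by functions rather than by classes; everything below depends
  on them only through integrals and almost-everywhere statements.
\<close>

definition L2_space :: "real \<Rightarrow> (real \<Rightarrow> 'a::euclidean_space) set" where
  "L2_space \<tau> = {f. f \<in> borel_measurable (lebesgue_on {0..\<tau>}) \<and>
                    integrable (lebesgue_on {0..\<tau>}) (\<lambda>t. (norm (f t))\<^sup>2)}"

definition abs_continuous_on :: "real set \<Rightarrow> (real \<Rightarrow> 'a::real_normed_vector) \<Rightarrow> bool" where
  "abs_continuous_on I f \<longleftrightarrow>
     (\<forall>\<epsilon>>0. \<exists>\<delta>>0. \<forall>D d. D division_of d \<and> d \<subseteq> I \<and> (\<Sum>K\<in>D. Sup K - Inf K) < \<delta>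
        \<longrightarrow> (\<Sum>K\<in>D. norm (f (Sup K) - f (Inf K))) < \<epsilon>)"

definition deriv_on :: "real \<Rightarrow> (real \<Rightarrow> 'a::real_normed_vector) \<Rightarrow> real \<Rightarrow> 'a" where
  "deriv_on \<tau> f t = vector_derivative f (at t within {0..\<tau>})"

text \<open>
  The almost-everywhere differentiability below is automatic for absolutely continuous functions
  into a Euclidean space (Lebesgue).  It is listed because \<^const>\<open>vector_derivative\<close> is a total
  function, so that membership of the derivative in \<open>L\<^sup>2\<close> does not by itself say that the
  derivative exists.
\<close>

definition H1_space :: "real \<Rightarrow> (real \<Rightarrow> 'a::euclidean_space) set" where
  "H1_space \<tau> = {f. abs_continuous_on {0..\<tau>} f \<and>
                    (AE t in lebesgue_on {0..\<tau>}. f differentiable (at t within {0..\<tau>})) \<and>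
                    deriv_on \<tau> f \<in> L2_space \<tau>}"

text \<open>
  Functions on \<open>[0, \<tau>]\<close> are represented by their extension by zero, so that elements of
  \<open>H\<^sup>1\<^sub>0\<close> are equal as HOL functions iff they agree on \<open>[0, \<tau>]\<close>.  This representation is closed
  under pointwise addition and scaling.
\<close>

definition H10_space :: "real \<Rightarrow> (real \<Rightarrow> real) set" where
  "H10_space \<tau> = {\<phi> \<in> H1_space \<tau>. \<phi> 0 = 0 \<and> \<phi> \<tau> = 0 \<and> (\<forall>t. t \<notin> {0..\<tau>} \<longrightarrow> \<phi> t = 0)}"

definition H10_inner :: "real \<Rightarrow> (real \<Rightarrow> real) \<Rightarrow> (real \<Rightarrow> real) \<Rightarrow> real" where
  "H10_inner \<tau> \<phi> \<psi> = (LINT t|lebesgue_on {0..\<tau>}. deriv_on \<tau> \<phi> t * deriv_on \<tau> \<psi> t)"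

definition H10_norm :: "real \<Rightarrow> (real \<Rightarrow> real) \<Rightarrow> real" where
  "H10_norm \<tau> \<phi> = sqrt (H10_inner \<tau> \<phi> \<phi>)"

section \<open>Operators between \<open>H\<^sup>1\<^sub>0[0, \<tau>]\<close> and Euclidean spaces\<close>

text \<open>
  An operator on \<open>H\<^sup>1\<^sub>0[0, \<tau>]\<close> is a HOL function on \<^typ>\<open>real \<Rightarrow> real\<close> whose values outside
  \<^const>\<open>H10_space\<close> are never used.
\<close>

definition synthesis :: "real \<Rightarrow> (real \<Rightarrow> real ^ 'k) \<Rightarrow> (real \<Rightarrow> real) \<Rightarrow> real ^ 'k" where
  "synthesis \<tau> f \<phi> = (LINT t|lebesgue_on {0..\<tau>}. \<phi> t *\<^sub>R f t)"

definition diff_synthesis :: "real \<Rightarrow> (real \<Rightarrow> real ^ 'k) \<Rightarrow> (real \<Rightarrow> real) \<Rightarrow> real ^ 'k" where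
  "diff_synthesis \<tau> f \<phi> = - (LINT t|lebesgue_on {0..\<tau>}. deriv_on \<tau> \<phi> t *\<^sub>R f t)"

definition H10_adjoint ::
    "real \<Rightarrow> ((real \<Rightarrow> real) \<Rightarrow> real ^ 'k) \<Rightarrow> real ^ 'k \<Rightarrow> (real \<Rightarrow> real)" where
  "H10_adjoint \<tau> T v =
     (THE \<psi>. \<psi> \<in> H10_space \<tau> \<and> (\<forall>\<phi>\<in>H10_space \<tau>. T \<phi> \<bullet> v = H10_inner \<tau> \<phi> \<psi>))"

definition H10_bounded_linear :: "real \<Rightarrow> (real ^ 'k \<Rightarrow> (real \<Rightarrow> real)) \<Rightarrow> bool" where
  "H10_bounded_linear \<tau> S \<longleftrightarrow>
     (\<forall>v. S v \<in> H10_space \<tau>) \<and>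
     (\<forall>v w. S (v + w) = (\<lambda>t. S v t + S w t)) \<and>
     (\<forall>c v. S (c *\<^sub>R v) = (\<lambda>t. c * S v t)) \<and>
     (\<exists>C. \<forall>v. H10_norm \<tau> (S v) \<le> C * norm v)"

definition H10_right_inverse ::
    "real \<Rightarrow> ((real \<Rightarrow> real) \<Rightarrow> real ^ 'k) \<Rightarrow> (real ^ 'k \<Rightarrow> (real \<Rightarrow> real)) \<Rightarrow> bool" where
  "H10_right_inverse \<tau> T S \<longleftrightarrow> H10_bounded_linear \<tau> S \<and> (\<forall>v. T (S v) = v)"

section \<open>Systems and data\<close>

definition hurwitz :: "real ^ 'n ^ 'n \<Rightarrow> bool" where
  "hurwitz M \<longleftrightarrow>
     (\<forall>(z::complex) (v::complex ^ 'n). v \<noteq> 0 \<and> map_matrix complex_of_real M *v v = z *s v \<longrightarrow> Re z < 0)"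

definition data_space :: "real \<Rightarrow> ((real \<Rightarrow> real ^ 'n) \<times> (real \<Rightarrow> real ^ 'm)) set" where
  "data_space \<tau> = H1_space \<tau> \<times> L2_space \<tau>"

definition compatible_systems ::
    "real \<Rightarrow> ((real \<Rightarrow> real ^ 'n) \<times> (real \<Rightarrow> real ^ 'm)) \<Rightarrow> ((real ^ 'n ^ 'n) \<times> (real ^ 'm ^ 'n)) set" where
  "compatible_systems \<tau> = (\<lambda>(x, u). {(A, B).
     AE t in lebesgue_on {0..\<tau>}. (x has_vector_derivative (A *v x t + B *v u t)) (at t within {0..\<tau>})})"

definition informative_for_stabilization ::
    "real \<Rightarrow> ((real \<Rightarrow> real ^ 'n) \<times> (real \<Rightarrow> real ^ 'm)) \<Rightarrow> bool" where
  "informative_for_stabilization \<tau> \<DD> \<longleftrightarrow>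
     (\<exists>K :: real ^ 'n ^ 'm. \<forall>(A, B) \<in> compatible_systems \<tau> \<DD>. hurwitz (A + B ** K))"

end

theory Submission
  imports Defs "HOL-Real_Asymp.Real_Asymp"
begin

text \<open>
  Integration by parts turns the differential equation \<open>x' = A x + B u\<close> into the operator equation
  \<open>X\<^sub>d = A X + B U\<close> (\<open>diff_synthesis_eq_of_compatible\<close>). Composing it with a right inverse
  \<open>S\<close> of \<open>X\<close> gives \<open>A + B (U S) = X\<^sub>d S\<close> for every compatible
  system (\<open>closed_loop_eq\<close>). The gain \<open>K = U S\<close> therefore
  produces the same closed loop for all of them, and a right inverse with \<open>X\<^sub>d S\<close> Hurwitz yields a
  stabilizing gain.

  Conversely, every stabilizing gain arises in this way (\<open>informative_imp_right_inverse\<close>).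
  Otherwise a linear relation \<open>a \<bullet> x + b \<bullet> u = 0\<close> in the data would provide compatible
  rank-one perturbations of the system that move the closed loop in an arbitrary direction \<open>w\<close>, and
  some \<open>w\<close> would create the eigenvalue 1. To pass from orthogonality of the synthesis operators to the
  relation almost everywhere, the fundamental lemma of the calculus of variations is needed
  (\<open>AE_eq_0_if_orthogonal_to_H10_space\<close>).

  It remains to parametrize \<open>X\<^sub>d S\<close> over all right inverses. Put \<open>W = X X\<^sup>*\<close>,
  which is invertible when \<open>X\<close> is onto, and let
  \<open>P = I - X\<^sup>* W\<^sup>-\<^sup>1 X\<close> be the projection onto the kernel of \<open>X\<close>. Any right inverse is
  \<open>X\<^sup>* W\<^sup>-\<^sup>1 + P S\<close>, so \<open>X\<^sub>d S = F + X\<^sub>d P S\<close>. Since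
  \<open>G = (X\<^sub>d P) (X\<^sub>d P)\<^sup>*\<close> and \<open>X\<^sub>d P\<close> have the same range, the matrices
  \<open>X\<^sub>d S\<close> are exactly the matrices \<open>F + G H\<close>. The inclusion of the former in the latter is
  \<open>right_inverse_factorization\<close>; the other one comes from the explicit right inverse
  \<open>X\<^sup>* W\<^sup>-\<^sup>1 + P X\<^sub>d\<^sup>* H\<close>, for which \<open>U S\<close> is the gain in the theorem.

  On the analytic side two facts carry the argument: the fundamental theorem of calculus for absolutely
  continuous functions (\<open>abs_continuous_has_integral\<close>), behind both integration by parts and
  definiteness of the inner product, and the existence of the adjoints of \<open>X\<close> and \<open>X\<^sub>d\<close>,
  whose values are explicit antiderivatives because \<open>x\<close> is continuous
  (\<open>H10_deriv_pairing_representer\<close>).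
\<close>

section \<open>The fundamental theorem of calculus for absolutely continuous functions\<close>

text \<open>
  The Henstock--Kurzweil integral gives a direct proof. Choose the gauge so that a cell whose tag lies
  outside \<open>N\<close> is so short that the difference quotient is accurate on it, and a cell whose tag
  lies in \<open>N\<close> stays inside an open set of small measure covering \<open>N\<close>. The cells of
  the first kind are controlled as in the classical theorem; those of the second kind have small total
  length, so absolute continuity makes their total increment small.
\<close>
lemma abs_continuous_has_integral:
  fixes f :: "real \<Rightarrow> 'a::euclidean_space"
  assumes ab: "a \<le> b" and ac: "abs_continuous_on {a..b} f" and N: "negligible N"
    and der: "\<And>t. t \<in> {a..b} - N \<Longrightarrow> (f has_vector_derivative f' t) (at t within {a..b})"
  shows "(f' has_integral (f b - f a)) {a..b}"
proof -
  \<comment> \<open>Redefining the derivative as zero on the null set reduces the error of a cell tagged there to its increment.\<close>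
  define g where "g t = (if t \<in> N then 0 else f' t)" for t
  have "(g has_integral (f b - f a)) (cbox a b)"
    unfolding has_integral
  proof (intro allI impI)
    fix e :: real assume e: "e > 0"
    \<comment> \<open>The summand 1 covers the degenerate case \<open>a = b\<close>.\<close>
    define \<eta> where "\<eta> = e / 2 / (b - a + 1)"
    have \<eta>: "\<eta> > 0" "\<eta> * (b - a) < e / 2"
      using e ab by (auto simp: \<eta>_def field_simps)
    from ac e obtain \<delta> where \<delta>: "\<delta> > 0" "\<And>D d. \<lbrakk>D division_of d; d \<subseteq> {a..b}; (\<Sum>K\<in>D. Sup K - Inf K) < \<delta>\<rbrakk>
        \<Longrightarrow> (\<Sum>K\<in>D. norm (f (Sup K) - f (Inf K))) < e / 2"
      unfolding abs_continuous_on_def by (meson half_gt_zero)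
    have Nnull: "N \<in> null_sets lebesgue"
      using N negligible_iff_null_sets by blast
    obtain T where T: "open T" "N \<subseteq> T" "(T - N) \<in> lmeasurable" "emeasure lebesgue (T - N) < ennreal \<delta>"
      using sets_lebesgue_outer_open[of N \<delta>] Nnull \<delta>(1) by blast
    have "emeasure lebesgue T = emeasure lebesgue (T - N)"
      using T(1) Nnull by (subst emeasure_Diff_null_set) auto
    with T have Tm: "T \<in> lmeasurable" "measure lebesgue T < \<delta>"
      using \<delta>(1) by (auto simp: fmeasurable_def measure_def enn2real_less_iff less_top intro: order_less_trans)
    have "\<forall>t. \<exists>r>0. (t \<in> N \<longrightarrow> ball t r \<subseteq> T) \<and> (t \<in> {a..b} - N \<longrightarrow>
         (\<forall>y\<in>{a..b}. norm (y-t) < r \<longrightarrow> norm (f y - f t - (y-t) *\<^sub>R f' t) \<le> \<eta> * norm (y-t)))"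
    proof
      fix t
      show "\<exists>r>0. (t \<in> N \<longrightarrow> ball t r \<subseteq> T) \<and> (t \<in> {a..b} - N \<longrightarrow>
         (\<forall>y\<in>{a..b}. norm (y-t) < r \<longrightarrow> norm (f y - f t - (y-t) *\<^sub>R f' t) \<le> \<eta> * norm (y-t)))"
      proof (cases "t \<in> N")
        case True
        then obtain r where "r > 0" "ball t r \<subseteq> T"
          using T(1,2) open_contains_ball by (metis subsetD)
        with True show ?thesis by auto
      next
        case False
        show ?thesis
        proof (cases "t \<in> {a..b}")
          case True
          with der[of t] False \<eta>(1) show ?thesis
            unfolding has_vector_derivative_def has_derivative_within_alt by auto
        next
          case not_ab: False
          with False show ?thesis by (intro exI[of _ 1]) auto
        qed
      qed
    qed
    then obtain r where r: "\<And>t. r t > 0" "\<And>t. t \<in> N \<Longrightarrow> ball t (r t) \<subseteq> T"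
      and d: "\<And>t y. \<lbrakk>t \<in> {a..b} - N; y \<in> {a..b}; norm (y-t) < r t\<rbrakk>
         \<Longrightarrow> norm (f y - f t - (y-t) *\<^sub>R f' t) \<le> \<eta> * norm (y-t)"
      by metis
    show "\<exists>\<gamma>. gauge \<gamma> \<and> (\<forall>p. p tagged_division_of (cbox a b) \<and> \<gamma> fine p \<longrightarrow>
            norm ((\<Sum>(x,k)\<in>p. measure lborel k *\<^sub>R g x) - (f b - f a)) < e)"
    proof (intro exI[of _ "\<lambda>t. ball t (r t)"] conjI allI impI)
      show "gauge (\<lambda>t. ball t (r t))" using r(1) gauge_ball_dependent by blast
    next
      fix p assume p: "p tagged_division_of (cbox a b) \<and> (\<lambda>t. ball t (r t)) fine p"
      then have ptag: "p tagged_division_of (cbox a b)" and fine: "(\<lambda>t. ball t (r t)) fine p" by auto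
      have finp: "finite p" using ptag by blast
      define p1 where "p1 = {z \<in> p. fst z \<notin> N}"
      define p2 where "p2 = {z \<in> p. fst z \<in> N}"
      define E where "E = (\<lambda>(x,K). measure lborel K *\<^sub>R g x - (f (Sup K) - f (Inf K)))"
      have cell: "\<exists>u v. u \<le> v \<and> K = {u..v} \<and> x \<in> {u..v} \<and> {u..v} \<subseteq> {a..b} \<and> {u..v} \<subseteq> ball x (r x)"
        if inp: "(x,K) \<in> p" for x K
      proof -
        obtain u v where uv: "K = cbox u v" using tagged_division_ofD(4)[OF ptag inp] by blast
        moreover have "x \<in> K" "K \<subseteq> cbox a b" using tagged_division_ofD(2,3)[OF ptag inp] by auto
        moreover have "K \<subseteq> ball x (r x)" using fine inp by (auto simp: fine_def)
        ultimately show ?thesis by (intro exI[of _ u] exI[of _ v]) (simp add: subset_iff)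
      qed
      have fb: "f b - f a = (\<Sum>(x,K)\<in>p. f (Sup K) - f (Inf K))"
        and ba: "b - a = (\<Sum>(x,K)\<in>p. Sup K - Inf K)"
        using additive_tagged_division_1[OF ab, of p f] additive_tagged_division_1[OF ab, of p "\<lambda>x. x"] ptag by auto
      have "(\<Sum>(x,K)\<in>p. measure lborel K *\<^sub>R g x) - (f b - f a) = sum E p"
        unfolding fb E_def by (simp add: split_def sum_subtractf)
      also have "\<dots> = sum E p1 + sum E p2"
        using finp by (subst sum.union_disjoint[symmetric]) (auto simp: p1_def p2_def intro!: sum.cong)
      finally have split: "(\<Sum>(x,K)\<in>p. measure lborel K *\<^sub>R g x) - (f b - f a) = sum E p1 + sum E p2" .
      have "norm (sum E p1) \<le> (\<Sum>(x,K)\<in>p1. \<eta> * (Sup K - Inf K))"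
      proof (rule sum_norm_le)
        fix z assume z: "z \<in> p1"
        obtain x K where xK: "z = (x,K)" by force
        from z xK have inp: "(x,K) \<in> p" "x \<notin> N" by (auto simp: p1_def)
        from cell[OF inp(1)] obtain u v where uv: "u \<le> v" "K = {u..v}" "x \<in> {u..v}" "{u..v} \<subseteq> {a..b}"
          "{u..v} \<subseteq> ball x (r x)" by blast
        have x: "x \<in> {a..b} - N" using uv inp by auto
        have "u \<in> {u..v}" "v \<in> {u..v}" using uv(1) by auto
        then have near: "u \<in> ball x (r x)" "v \<in> ball x (r x)" "u \<in> {a..b}" "v \<in> {a..b}"
          using uv(4,5) by blast+
        have u: "norm (f u - f x - (u-x) *\<^sub>R f' x) \<le> \<eta> * norm (u-x)"
          using near by (intro d[OF x]) (auto simp: dist_real_def)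
        have v: "norm (f v - f x - (v-x) *\<^sub>R f' x) \<le> \<eta> * norm (v-x)"
          using near by (intro d[OF x]) (auto simp: dist_real_def)
        have "E z = (f u - f x - (u - x) *\<^sub>R f' x) - (f v - f x - (v - x) *\<^sub>R f' x)"
          using uv inp by (simp add: E_def xK g_def algebra_simps)
        then have "norm (E z) \<le> norm (f u - f x - (u - x) *\<^sub>R f' x) + norm (f v - f x - (v - x) *\<^sub>R f' x)"
          by (metis norm_triangle_ineq4)
        also have "\<dots> \<le> \<eta> * norm (u-x) + \<eta> * norm (v-x)" using u v by linarith
        also have "\<dots> = \<eta> * (v - u)" using uv by (auto simp: algebra_simps)
        finally show "norm (E z) \<le> (case z of (x,K) \<Rightarrow> \<eta> * (Sup K - Inf K))"
          using uv by (simp add: xK)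
      qed
      also have "\<dots> \<le> (\<Sum>(x,K)\<in>p. \<eta> * (Sup K - Inf K))"
      proof (rule sum_mono2[OF finp])
        fix z assume z: "z \<in> p - p1"
        obtain x K where xK: "z = (x,K)" by force
        from z xK have "(x,K) \<in> p" by auto
        from cell[OF this] show "0 \<le> (case z of (x,K) \<Rightarrow> \<eta> * (Sup K - Inf K))"
          using \<eta>(1) by (auto simp: xK)
      qed (auto simp: p1_def)
      also have "\<dots> = \<eta> * (b - a)" by (simp add: ba sum_distrib_left split_def)
      finally have 1: "norm (sum E p1) < e / 2" using \<eta>(2) by linarith
      have "p tagged_partial_division_of (cbox a b)"
        using ptag by (simp only: tagged_division_of_def)
      moreover have "p2 \<subseteq> p" unfolding p2_def by blast
      ultimately have p2tag: "p2 tagged_partial_division_of (cbox a b)"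
        by (rule tagged_partial_division_subset)
      define D where "D = snd ` p2"
      have Ddiv: "D division_of \<Union>D"
        using partial_division_of_tagged_division[OF p2tag] by (simp add: D_def)
      have cellD: "\<exists>u v. u \<le> v \<and> K = {u..v} \<and> {u..v} \<subseteq> {a..b} \<and> {u..v} \<subseteq> T" if KD: "K \<in> D" for K
      proof -
        from KD obtain x where x: "(x,K) \<in> p" "x \<in> N" by (auto simp: D_def p2_def)
        from cell[OF x(1)] r(2)[OF x(2)] show ?thesis by blast
      qed
      have finD: "finite D" using Ddiv by blast
      have "(\<Sum>K\<in>D. Sup K - Inf K) = (\<Sum>K\<in>D. measure lebesgue K)"
        by (rule sum.cong) (use cellD in fastforce)+
      also have "\<dots> = measure lebesgue (\<Union>D)"
      proof (rule measure_negligible_finite_Union[symmetric])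
        show "pairwise (\<lambda>S T. negligible (S \<inter> T)) D"
        proof (rule pairwiseI)
          fix K L assume KL: "K \<in> D" "L \<in> D" "K \<noteq> L"
          with Ddiv have "interior K \<inter> interior L = {}" by blast
          moreover obtain u v u' v' where "K = {u..v}" "L = {u'..v'}" using cellD KL by metis
          ultimately have "interior (K \<inter> L) = {}" "K \<inter> L = cbox (max u u') (min v v')" by (auto simp: interior_Int)
          then show "negligible (K \<inter> L)"
            by (metis interior_cbox negligible_interval(1))
        qed
      qed (use finD cellD in fastforce)+
      also have "\<dots> \<le> measure lebesgue T"
      proof (rule measure_mono_fmeasurable)
        show "\<Union>D \<subseteq> T" using cellD by fastforce
        show "\<Union>D \<in> sets lebesgue" using finD cellD by (intro sets.finite_Union) fastforce+
      qed (rule Tm)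
      finally have len: "(\<Sum>K\<in>D. Sup K - Inf K) < \<delta>" using Tm by linarith
      \<comment> \<open>The case distinction makes the summand vanish on the empty interval, as the passage from tagged
        cells to cells requires; \<open>Sup {}\<close> and \<open>Inf {}\<close> are unspecified.\<close>
      have "norm (sum E p2) \<le> (\<Sum>(x,K)\<in>p2. if K = {} then 0 else norm (f (Sup K) - f (Inf K)))"
      proof (rule sum_norm_le)
        fix z assume z: "z \<in> p2"
        obtain x K where xK: "z = (x,K)" by force
        from z xK have "K \<in> D" "x \<in> N" by (auto simp: p2_def D_def image_iff)
        then show "norm (E z) \<le> (case z of (x,K) \<Rightarrow> if K = {} then 0 else norm (f (Sup K) - f (Inf K)))"
          using cellD[of K] by (auto simp: xK E_def g_def norm_minus_commute)
      qed
      also have "\<dots> = (\<Sum>K\<in>D. if K = {} then 0 else norm (f (Sup K) - f (Inf K)))"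
        unfolding D_def
        by (rule sum.over_tagged_division_lemma[OF tagged_partial_division_of_Union_self[OF p2tag]])
           (auto simp: box_real not_less)
      also have "\<dots> = (\<Sum>K\<in>D. norm (f (Sup K) - f (Inf K)))"
        by (rule sum.cong) (use cellD in fastforce)+
      also have "\<dots> < e / 2" 
        using cellD by (intro \<delta>(2)[OF Ddiv _ len]) fastforce
      finally show "norm ((\<Sum>(x,k)\<in>p. measure lborel k *\<^sub>R g x) - (f b - f a)) < e"
        unfolding split using 1 norm_triangle_ineq[of "sum E p1" "sum E p2"] by linarith
    qed
  qed
  then show ?thesis
    by (intro has_integral_spike[OF N, of _ f' g]) (auto simp: g_def)
qed

section \<open>Square-integrable functions\<close>

lemma L2_space_iff:
  "f \<in> L2_space \<tau> \<longleftrightarrow> f \<in> borel_measurable (lebesgue_on {0..\<tau>}) \<and>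
     integrable (lebesgue_on {0..\<tau>}) (\<lambda>t. (norm (f t))\<^sup>2)"
  by (simp add: L2_space_def)

lemma L2_space_measurable [measurable_dest]:
  "f \<in> L2_space \<tau> \<Longrightarrow> f \<in> borel_measurable (lebesgue_on {0..\<tau>})"
  by (simp add: L2_space_iff)

lemma L2_space_scaleR_integrable:
  fixes g :: "real \<Rightarrow> 'a::euclidean_space"
  assumes "f \<in> L2_space \<tau>" "g \<in> L2_space \<tau>"
  shows "integrable (lebesgue_on {0..\<tau>}) (\<lambda>t. f t *\<^sub>R g t)"
proof (rule Bochner_Integration.integrable_bound)
  show "integrable (lebesgue_on {0..\<tau>}) (\<lambda>t. (norm (f t))\<^sup>2 + (norm (g t))\<^sup>2)"
    using assms by (auto simp: L2_space_iff)
  show "(\<lambda>t. f t *\<^sub>R g t) \<in> borel_measurable (lebesgue_on {0..\<tau>})"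
    using assms by measurable
  show "AE t in lebesgue_on {0..\<tau>}. norm (f t *\<^sub>R g t) \<le> norm ((norm (f t))\<^sup>2 + (norm (g t))\<^sup>2)"
  proof (rule AE_I2)
    fix t
    have "2 * (norm (f t) * norm (g t)) \<le> (norm (f t))\<^sup>2 + (norm (g t))\<^sup>2"
      using sum_squares_bound[of "norm (f t)" "norm (g t)"] by simp
    moreover have "0 \<le> norm (f t) * norm (g t)" by simp
    ultimately have "norm (f t) * norm (g t) \<le> (norm (f t))\<^sup>2 + (norm (g t))\<^sup>2"
      by linarith
    then show "norm (f t *\<^sub>R g t) \<le> norm ((norm (f t))\<^sup>2 + (norm (g t))\<^sup>2)"
      by simp
  qed
qed

text \<open>
  Measurability survives the change because Lebesgue measure is complete.
\<close>
lemma L2_space_cong_AE: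
  fixes f g :: "real \<Rightarrow> 'a::euclidean_space"
  assumes f: "f \<in> L2_space \<tau>" and ae: "AE t in lebesgue_on {0..\<tau>}. f t = g t"
  shows "g \<in> L2_space \<tau>"
proof -
  have S: "{0..\<tau>} \<in> sets lebesgue" by simp
  have "(\<lambda>t. if t \<in> {0..\<tau>} then f t else 0) \<in> borel_measurable lebesgue"
    using borel_measurable_if_lebesgue_on[OF S, of UNIV f] f by (simp add: L2_space_iff lebesgue_on_UNIV_eq)
  moreover have "AE t in lebesgue. (if t \<in> {0..\<tau>} then f t else 0) = (if t \<in> {0..\<tau>} then g t else 0)"
    using ae by (subst (asm) AE_restrict_space_iff) (auto elim: eventually_mono)
  ultimately have "(\<lambda>t. if t \<in> {0..\<tau>} then g t else 0) \<in> borel_measurable lebesgue"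
    by (rule borel_measurable_AE)
  then have g: "g \<in> borel_measurable (lebesgue_on {0..\<tau>})"
    using borel_measurable_if_lebesgue_on[OF S, of UNIV g] by (simp add: lebesgue_on_UNIV_eq)
  have "integrable (lebesgue_on {0..\<tau>}) (\<lambda>t. (norm (g t))\<^sup>2)"
  proof (rule integrable_cong_AE_imp)
    show "integrable (lebesgue_on {0..\<tau>}) (\<lambda>t. (norm (f t))\<^sup>2)" using f by (simp add: L2_space_iff)
  qed (use g ae in auto)
  with g show ?thesis by (simp add: L2_space_iff)
qed

lemma L2_space_add:
  fixes f g :: "real \<Rightarrow> 'a::euclidean_space"
  assumes "f \<in> L2_space \<tau>" "g \<in> L2_space \<tau>"
  shows "(\<lambda>t. f t + g t) \<in> L2_space \<tau>"
  unfolding L2_space_iff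
proof (intro conjI)
  show m: "(\<lambda>t. f t + g t) \<in> borel_measurable (lebesgue_on {0..\<tau>})" using assms by measurable
  show "integrable (lebesgue_on {0..\<tau>}) (\<lambda>t. (norm (f t + g t))\<^sup>2)"
  proof (rule Bochner_Integration.integrable_bound)
    show "integrable (lebesgue_on {0..\<tau>}) (\<lambda>t. 2 * (norm (f t))\<^sup>2 + 2 * (norm (g t))\<^sup>2)"
      using assms by (auto simp: L2_space_iff)
    show "(\<lambda>t. (norm (f t + g t))\<^sup>2) \<in> borel_measurable (lebesgue_on {0..\<tau>})" using m by measurable
    show "AE t in lebesgue_on {0..\<tau>}. norm ((norm (f t + g t))\<^sup>2) \<le> norm (2 * (norm (f t))\<^sup>2 + 2 * (norm (g t))\<^sup>2)"
    proof (rule AE_I2)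
      fix t
      have "(norm (f t + g t))\<^sup>2 \<le> (norm (f t) + norm (g t))\<^sup>2"
        by (simp add: norm_triangle_ineq power_mono)
      also have "\<dots> \<le> 2 * (norm (f t))\<^sup>2 + 2 * (norm (g t))\<^sup>2"
        using sum_squares_bound[of "norm (f t)" "norm (g t)"] by (simp add: power2_sum)
      finally show "norm ((norm (f t + g t))\<^sup>2) \<le> norm (2 * (norm (f t))\<^sup>2 + 2 * (norm (g t))\<^sup>2)"
        by simp
    qed
  qed
qed

lemma L2_space_bounded_scaleR:
  fixes f :: "real \<Rightarrow> 'a::euclidean_space" and h :: "real \<Rightarrow> real"
  assumes f: "f \<in> L2_space \<tau>" and h: "h \<in> borel_measurable (lebesgue_on {0..\<tau>})"
    and bd: "\<And>t. t \<in> {0..\<tau>} \<Longrightarrow> \<bar>h t\<bar> \<le> M"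
  shows "(\<lambda>t. h t *\<^sub>R f t) \<in> L2_space \<tau>"
  unfolding L2_space_iff
proof (intro conjI)
  show m: "(\<lambda>t. h t *\<^sub>R f t) \<in> borel_measurable (lebesgue_on {0..\<tau>})" using assms by measurable
  show "integrable (lebesgue_on {0..\<tau>}) (\<lambda>t. (norm (h t *\<^sub>R f t))\<^sup>2)"
  proof (rule Bochner_Integration.integrable_bound)
    show "integrable (lebesgue_on {0..\<tau>}) (\<lambda>t. M\<^sup>2 * (norm (f t))\<^sup>2)"
      using f by (auto simp: L2_space_iff)
    show "(\<lambda>t. (norm (h t *\<^sub>R f t))\<^sup>2) \<in> borel_measurable (lebesgue_on {0..\<tau>})" using m by measurable
    show "AE t in lebesgue_on {0..\<tau>}. norm ((norm (h t *\<^sub>R f t))\<^sup>2) \<le> norm (M\<^sup>2 * (norm (f t))\<^sup>2)"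
    proof (rule AE_I2)
      fix t assume "t \<in> space (lebesgue_on {0..\<tau>})"
      then have "\<bar>h t\<bar>\<^sup>2 \<le> M\<^sup>2" using bd by (intro power_mono) auto
      then show "norm ((norm (h t *\<^sub>R f t))\<^sup>2) \<le> norm (M\<^sup>2 * (norm (f t))\<^sup>2)"
        by (simp add: power_mult_distrib mult_right_mono)
    qed
  qed
qed

lemma continuous_on_imp_L2_space:
  fixes f :: "real \<Rightarrow> 'a::euclidean_space"
  assumes "continuous_on {0..\<tau>} f"
  shows "f \<in> L2_space \<tau>"
  unfolding L2_space_iff
  using assms by (auto intro!: continuous_imp_measurable_on_sets_lebesgue continuous_imp_integrable_real continuous_intros)

lemma L2_space_bounded_linear:
  fixes f :: "real \<Rightarrow> 'a::euclidean_space" and L :: "'a \<Rightarrow> 'b::euclidean_space"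
  assumes f: "f \<in> L2_space \<tau>" and L: "bounded_linear L"
  shows "(\<lambda>t. L (f t)) \<in> L2_space \<tau>"
  unfolding L2_space_iff
proof (intro conjI)
  have Lb: "L \<in> borel_measurable borel" using L
    by (intro borel_measurable_continuous_onI linear_continuous_on)
  show m: "(\<lambda>t. L (f t)) \<in> borel_measurable (lebesgue_on {0..\<tau>})"
    using measurable_compose[OF L2_space_measurable[OF f] Lb] .
  obtain K where K: "\<And>x. norm (L x) \<le> norm x * K" "K \<ge> 0"
    using bounded_linear.nonneg_bounded[OF L] by blast
  show "integrable (lebesgue_on {0..\<tau>}) (\<lambda>t. (norm (L (f t)))\<^sup>2)"
  proof (rule Bochner_Integration.integrable_bound)
    show "integrable (lebesgue_on {0..\<tau>}) (\<lambda>t. K\<^sup>2 * (norm (f t))\<^sup>2)"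
      using f by (auto simp: L2_space_iff)
    show "(\<lambda>t. (norm (L (f t)))\<^sup>2) \<in> borel_measurable (lebesgue_on {0..\<tau>})" using m by measurable
    show "AE t in lebesgue_on {0..\<tau>}. norm ((norm (L (f t)))\<^sup>2) \<le> norm (K\<^sup>2 * (norm (f t))\<^sup>2)"
    proof (rule AE_I2)
      fix t
      have "(norm (L (f t)))\<^sup>2 \<le> (norm (f t) * K)\<^sup>2" using K by (intro power_mono) auto
      then show "norm ((norm (L (f t)))\<^sup>2) \<le> norm (K\<^sup>2 * (norm (f t))\<^sup>2)"
        by (simp add: power_mult_distrib mult.commute)
    qed
  qed
qed

lemma L2_space_integrable:
  fixes f :: "real \<Rightarrow> 'a::euclidean_space"
  assumes "f \<in> L2_space \<tau>"
  shows "integrable (lebesgue_on {0..\<tau>}) f"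
  using L2_space_scaleR_integrable[OF continuous_on_imp_L2_space assms, of "\<lambda>_. 1"] by simp

section \<open>Absolutely continuous functions with square-integrable derivative\<close>

text \<open>
  The constant \<^const>\<open>deriv_on\<close> respects sums and products only almost everywhere. Naming
  the derivative as a second argument, determined up to a null set, gives closure rules without such
  side conditions.
\<close>
definition has_H1_deriv :: "real \<Rightarrow> (real \<Rightarrow> 'a::euclidean_space) \<Rightarrow> (real \<Rightarrow> 'a) \<Rightarrow> bool" where
  "has_H1_deriv \<tau> f g \<longleftrightarrow> abs_continuous_on {0..\<tau>} f \<and> g \<in> L2_space \<tau> \<and>
     (AE t in lebesgue_on {0..\<tau>}. (f has_vector_derivative g t) (at t within {0..\<tau>}))"

lemma deriv_on_unique:
  assumes "\<tau> > 0" "t \<in> {0..\<tau>}" "(f has_vector_derivative g) (at t within {0..\<tau>})"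
  shows "deriv_on \<tau> f t = g"
  using vector_derivative_within_cbox[of 0 \<tau> t f g] assms by (simp add: deriv_on_def box_real)

lemma has_H1_deriv_deriv_on:
  assumes "\<tau> > 0" "has_H1_deriv \<tau> f g"
  shows "AE t in lebesgue_on {0..\<tau>}. deriv_on \<tau> f t = g t"
proof -
  have "AE t in lebesgue_on {0..\<tau>}. (f has_vector_derivative g t) (at t within {0..\<tau>})"
    using assms(2) by (simp add: has_H1_deriv_def)
  then show ?thesis
    by (rule lebesgue_on_mono) (rule deriv_on_unique[OF assms(1)])
qed

lemma has_H1_deriv_imp_H1_space:
  fixes f :: "real \<Rightarrow> 'a::euclidean_space"
  assumes "\<tau> > 0" "has_H1_deriv \<tau> f g"
  shows "f \<in> H1_space \<tau>"
proof -
  have ae: "AE t in lebesgue_on {0..\<tau>}. g t = deriv_on \<tau> f t"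
    using has_H1_deriv_deriv_on[OF assms] by (auto elim: eventually_mono)
  have "AE t in lebesgue_on {0..\<tau>}. (f has_vector_derivative g t) (at t within {0..\<tau>})"
    using assms(2) by (simp add: has_H1_deriv_def)
  then have "AE t in lebesgue_on {0..\<tau>}. f differentiable (at t within {0..\<tau>})"
    by (rule eventually_mono) (auto simp: differentiableI_vector)
  with assms L2_space_cong_AE[OF _ ae] show ?thesis
    by (auto simp: H1_space_def has_H1_deriv_def)
qed

lemma H1_space_has_H1_deriv:
  fixes f :: "real \<Rightarrow> 'a::euclidean_space"
  assumes "f \<in> H1_space \<tau>"
  shows "has_H1_deriv \<tau> f (deriv_on \<tau> f)"
proof -
  have "AE t in lebesgue_on {0..\<tau>}. f differentiable (at t within {0..\<tau>})"
    using assms by (simp add: H1_space_def)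
  then have "AE t in lebesgue_on {0..\<tau>}. (f has_vector_derivative deriv_on \<tau> f t) (at t within {0..\<tau>})"
    by (rule eventually_mono) (auto simp: deriv_on_def vector_derivative_works[symmetric])
  with assms show ?thesis by (auto simp: H1_space_def has_H1_deriv_def)
qed

text \<open>
  One criterion for sums, products and Lipschitz functions: increments of \<open>h\<close> are dominated
  by those of two absolutely continuous functions.
\<close>
lemma abs_continuous_on_combine:
  fixes f :: "real \<Rightarrow> 'a::real_normed_vector" and g :: "real \<Rightarrow> 'b::real_normed_vector"
    and h :: "real \<Rightarrow> 'c::real_normed_vector"
  assumes f: "abs_continuous_on I f" and g: "abs_continuous_on I g" and M: "M \<ge> 0"
    and h: "\<And>s t. \<lbrakk>s \<in> I; t \<in> I\<rbrakk> \<Longrightarrow> norm (h t - h s) \<le> M * (norm (f t - f s) + norm (g t - g s))"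
  shows "abs_continuous_on I h"
  unfolding abs_continuous_on_def
proof (intro allI impI)
  fix \<epsilon> :: real assume \<epsilon>: "\<epsilon> > 0"
  define \<eta> where "\<eta> = \<epsilon> / (M + 1) / 2"
  have "\<eta> + \<eta> = \<epsilon> / (M + 1)" unfolding \<eta>_def by (rule field_sum_of_halves)
  moreover have "M * (\<epsilon> / (M + 1)) < \<epsilon>" using \<epsilon> M by (simp add: pos_divide_less_eq algebra_simps)
  ultimately have \<eta>: "\<eta> > 0" "M * (\<eta> + \<eta>) < \<epsilon>" using \<epsilon> M by (auto simp: \<eta>_def)
  obtain \<delta>1 where 1: "\<delta>1 > 0" "\<And>D d. \<lbrakk>D division_of d; d \<subseteq> I; (\<Sum>K\<in>D. Sup K - Inf K) < \<delta>1\<rbrakk>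
        \<Longrightarrow> (\<Sum>K\<in>D. norm (f (Sup K) - f (Inf K))) < \<eta>"
    using f \<eta>(1) unfolding abs_continuous_on_def by metis
  obtain \<delta>2 where 2: "\<delta>2 > 0" "\<And>D d. \<lbrakk>D division_of d; d \<subseteq> I; (\<Sum>K\<in>D. Sup K - Inf K) < \<delta>2\<rbrakk>
        \<Longrightarrow> (\<Sum>K\<in>D. norm (g (Sup K) - g (Inf K))) < \<eta>"
    using g \<eta>(1) unfolding abs_continuous_on_def by metis
  show "\<exists>\<delta>>0. \<forall>D d. D division_of d \<and> d \<subseteq> I \<and> (\<Sum>K\<in>D. Sup K - Inf K) < \<delta>
        \<longrightarrow> (\<Sum>K\<in>D. norm (h (Sup K) - h (Inf K))) < \<epsilon>"
  proof (intro exI[of _ "min \<delta>1 \<delta>2"] conjI allI impI)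
    fix D d assume D: "D division_of d \<and> d \<subseteq> I \<and> (\<Sum>K\<in>D. Sup K - Inf K) < min \<delta>1 \<delta>2"
    have "(\<Sum>K\<in>D. norm (h (Sup K) - h (Inf K)))
        \<le> (\<Sum>K\<in>D. M * (norm (f (Sup K) - f (Inf K)) + norm (g (Sup K) - g (Inf K))))"
    proof (rule sum_mono)
      fix K assume K: "K \<in> D"
      with D obtain u v where uv: "K = cbox u v" by (metis division_ofD(4))
      have "K \<noteq> {}" "K \<subseteq> I" using D K division_ofD(2,3) by blast+
      with uv have "u \<le> v" "{u..v} \<subseteq> I" by (auto simp: box_real)
      then have "Inf K \<in> I" "Sup K \<in> I" using uv by auto
      then show "norm (h (Sup K) - h (Inf K)) \<le> M * (norm (f (Sup K) - f (Inf K)) + norm (g (Sup K) - g (Inf K)))"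
        by (rule h)
    qed
    also have "\<dots> = M * ((\<Sum>K\<in>D. norm (f (Sup K) - f (Inf K))) + (\<Sum>K\<in>D. norm (g (Sup K) - g (Inf K))))"
      by (simp add: sum_distrib_left[symmetric] sum.distrib)
    also have "\<dots> \<le> M * (\<eta> + \<eta>)"
      using 1(2)[of D d] 2(2)[of D d] D M by (intro mult_left_mono) auto
    finally show "(\<Sum>K\<in>D. norm (h (Sup K) - h (Inf K))) < \<epsilon>" using \<eta>(2) by linarith
  qed (use 1(1) 2(1) in auto)
qed

lemma abs_continuous_on_id: "abs_continuous_on I (\<lambda>t::real. t)"
  unfolding abs_continuous_on_def
proof (intro allI impI)
  fix \<epsilon> :: real assume \<epsilon>: "\<epsilon> > 0"
  show "\<exists>\<delta>>0. \<forall>D d. D division_of d \<and> d \<subseteq> I \<and> (\<Sum>K\<in>D. Sup K - Inf K) < \<delta>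
        \<longrightarrow> (\<Sum>K\<in>D. norm (Sup K - Inf K)) < \<epsilon>"
  proof (intro exI[of _ \<epsilon>] conjI allI impI)
    fix D d assume D: "D division_of d \<and> d \<subseteq> I \<and> (\<Sum>K\<in>D. Sup K - Inf K) < \<epsilon>"
    have "(\<Sum>K\<in>D. norm (Sup K - Inf K)) = (\<Sum>K\<in>D. Sup K - Inf K)"
    proof (rule sum.cong)
      fix K assume K: "K \<in> D"
      with D obtain u v where uv: "K = cbox u v" by (metis division_ofD(4))
      have "K \<noteq> {}" using D K division_ofD(3) by blast
      with uv show "norm (Sup K - Inf K) = Sup K - Inf K" by (auto simp: box_real)
    qed simp
    with D show "(\<Sum>K\<in>D. norm (Sup K - Inf K)) < \<epsilon>" by simp
  qed (use \<epsilon> in auto)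
qed

lemma abs_continuous_on_imp_continuous_on:
  fixes f :: "real \<Rightarrow> 'a::real_normed_vector"
  assumes "abs_continuous_on {a..b} f"
  shows "continuous_on {a..b} f"
  unfolding continuous_on_iff
proof (intro ballI allI impI)
  fix t e assume t: "t \<in> {a..b}" and e: "(e::real) > 0"
  obtain \<delta> where \<delta>: "\<delta> > 0" "\<And>D d. \<lbrakk>D division_of d; d \<subseteq> {a..b}; (\<Sum>K\<in>D. Sup K - Inf K) < \<delta>\<rbrakk>
        \<Longrightarrow> (\<Sum>K\<in>D. norm (f (Sup K) - f (Inf K))) < e"
    using assms e unfolding abs_continuous_on_def by metis
  have key: "norm (f v - f u) < e" if "u \<le> v" "u \<in> {a..b}" "v \<in> {a..b}" "v - u < \<delta>" for u v
    using \<delta>(2)[OF division_of_self[of u v]] that by auto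
  show "\<exists>d>0. \<forall>s\<in>{a..b}. dist s t < d \<longrightarrow> dist (f s) (f t) < e"
  proof (intro exI[of _ \<delta>] conjI ballI impI)
    fix s assume s: "s \<in> {a..b}" "dist s t < \<delta>"
    show "dist (f s) (f t) < e"
      using key[of s t] key[of t s] s t by (cases "s \<le> t") (auto simp: dist_norm norm_minus_commute)
  qed (rule \<delta>)
qed

lemma has_H1_deriv_continuous_on: "has_H1_deriv \<tau> f g \<Longrightarrow> continuous_on {0..\<tau>} f"
  by (simp add: has_H1_deriv_def abs_continuous_on_imp_continuous_on)

lemma has_H1_deriv_integral:
  fixes f :: "real \<Rightarrow> 'a::euclidean_space"
  assumes h: "has_H1_deriv \<tau> f g" and s: "s \<in> {0..\<tau>}"
  shows "(g has_integral (f s - f 0)) {0..s}"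
proof -
  have "AE t in lebesgue. t \<in> {0..\<tau>} \<longrightarrow> (f has_vector_derivative g t) (at t within {0..\<tau>})"
    using h by (subst AE_restrict_space_iff[symmetric]) (auto simp: has_H1_deriv_def)
  then obtain N where N: "N \<in> null_sets lebesgue"
    "\<And>t. t \<in> {0..\<tau>} \<Longrightarrow> t \<notin> N \<Longrightarrow> (f has_vector_derivative g t) (at t within {0..\<tau>})"
    unfolding completion.AE_iff_null_sets by auto
  have "abs_continuous_on {0..s} f"
    using h s unfolding has_H1_deriv_def abs_continuous_on_def
    by (meson atLeastAtMost_iff atLeastatMost_subset_iff order_refl subset_trans)
  then show ?thesis
  proof (rule abs_continuous_has_integral[rotated])
    show "negligible N" using N(1) negligible_iff_null_sets by blast
    show "(f has_vector_derivative g t) (at t within {0..s})" if "t \<in> {0..s} - N" for t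
      using that s by (intro has_vector_derivative_within_subset[OF N(2)]) auto
  qed (use s in auto)
qed

lemma has_H1_deriv_LINT:
  fixes f :: "real \<Rightarrow> 'a::euclidean_space"
  assumes "\<tau> > 0" and h: "has_H1_deriv \<tau> f g"
  shows "(LINT t|lebesgue_on {0..\<tau>}. g t) = f \<tau> - f 0"
proof -
  have "g \<in> L2_space \<tau>" using h by (simp add: has_H1_deriv_def)
  from has_integral_integral_lebesgue_on[OF L2_space_integrable[OF this]]
  have "(g has_integral (LINT t|lebesgue_on {0..\<tau>}. g t)) {0..\<tau>}" by simp
  with has_H1_deriv_integral[OF h, of \<tau>] assms(1) show ?thesis
    by (auto dest: has_integral_unique)
qed

lemma continuous_on_interval_bound:
  fixes f :: "real \<Rightarrow> 'a::real_normed_vector"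
  assumes "continuous_on {a..b} f"
  obtains M where "M \<ge> 0" "\<And>t. t \<in> {a..b} \<Longrightarrow> norm (f t) \<le> M"
proof -
  have "bounded (f ` {a..b})"
    using assms by (intro compact_imp_bounded compact_continuous_image) auto
  then obtain M where "M > 0" "\<forall>y\<in>f ` {a..b}. norm y \<le> M"
    unfolding bounded_pos by blast
  then show thesis by (intro that[of M]) auto
qed

lemma has_H1_deriv_add:
  fixes f g :: "real \<Rightarrow> 'a::euclidean_space"
  assumes "has_H1_deriv \<tau> f f'" "has_H1_deriv \<tau> g g'"
  shows "has_H1_deriv \<tau> (\<lambda>t. f t + g t) (\<lambda>t. f' t + g' t)"
  unfolding has_H1_deriv_def
proof (intro conjI)
  show "abs_continuous_on {0..\<tau>} (\<lambda>t. f t + g t)"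
  proof (rule abs_continuous_on_combine[of _ f g 1])
    fix s t
    have "f t + g t - (f s + g s) = (f t - f s) + (g t - g s)" by simp
    then show "norm (f t + g t - (f s + g s)) \<le> 1 * (norm (f t - f s) + norm (g t - g s))"
      using norm_triangle_ineq[of "f t - f s" "g t - g s"] by (simp only: mult_1)
  qed (use assms in \<open>auto simp: has_H1_deriv_def\<close>)
  show "(\<lambda>t. f' t + g' t) \<in> L2_space \<tau>" using assms by (auto simp: has_H1_deriv_def intro: L2_space_add)
  have "AE t in lebesgue_on {0..\<tau>}. (f has_vector_derivative f' t) (at t within {0..\<tau>})"
    "AE t in lebesgue_on {0..\<tau>}. (g has_vector_derivative g' t) (at t within {0..\<tau>})"
    using assms by (auto simp: has_H1_deriv_def)
  then show "AE t in lebesgue_on {0..\<tau>}. ((\<lambda>t. f t + g t) has_vector_derivative f' t + g' t) (at t within {0..\<tau>})"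
    by eventually_elim (rule has_vector_derivative_add)
qed

lemma has_H1_deriv_scaleR:
  fixes f :: "real \<Rightarrow> 'a::euclidean_space" and \<phi> :: "real \<Rightarrow> real"
  assumes p: "has_H1_deriv \<tau> \<phi> \<phi>'" and f: "has_H1_deriv \<tau> f f'"
  shows "has_H1_deriv \<tau> (\<lambda>t. \<phi> t *\<^sub>R f t) (\<lambda>t. \<phi> t *\<^sub>R f' t + \<phi>' t *\<^sub>R f t)"
proof -
  have cp: "continuous_on {0..\<tau>} \<phi>" and cf: "continuous_on {0..\<tau>} f"
    using p f has_H1_deriv_continuous_on by blast+
  obtain M1 where M1: "M1 \<ge> 0" "\<And>t. t \<in> {0..\<tau>} \<Longrightarrow> norm (\<phi> t) \<le> M1"
    using continuous_on_interval_bound[OF cp] by blast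
  obtain M2 where M2: "M2 \<ge> 0" "\<And>t. t \<in> {0..\<tau>} \<Longrightarrow> norm (f t) \<le> M2"
    using continuous_on_interval_bound[OF cf] by blast
  define M where "M = max M1 M2"
  have M: "M \<ge> 0" "\<And>t. t \<in> {0..\<tau>} \<Longrightarrow> \<bar>\<phi> t\<bar> \<le> M" "\<And>t. t \<in> {0..\<tau>} \<Longrightarrow> norm (f t) \<le> M"
    using M1 M2 by (auto simp: M_def le_max_iff_disj)
  show ?thesis
    unfolding has_H1_deriv_def
  proof (intro conjI)
    show "abs_continuous_on {0..\<tau>} (\<lambda>t. \<phi> t *\<^sub>R f t)"
    proof (rule abs_continuous_on_combine[of _ \<phi> f M])
      fix s t assume st: "s \<in> {0..\<tau>}" "t \<in> {0..\<tau>}"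
      have "\<phi> t *\<^sub>R f t - \<phi> s *\<^sub>R f s = (\<phi> t - \<phi> s) *\<^sub>R f t + \<phi> s *\<^sub>R (f t - f s)"
        by (simp add: algebra_simps)
      then have "norm (\<phi> t *\<^sub>R f t - \<phi> s *\<^sub>R f s) \<le> \<bar>\<phi> t - \<phi> s\<bar> * norm (f t) + \<bar>\<phi> s\<bar> * norm (f t - f s)"
        by (metis norm_scaleR norm_triangle_ineq)
      also have "\<dots> \<le> \<bar>\<phi> t - \<phi> s\<bar> * M + M * norm (f t - f s)"
        using M st by (intro add_mono mult_left_mono mult_right_mono) auto
      finally show "norm (\<phi> t *\<^sub>R f t - \<phi> s *\<^sub>R f s) \<le> M * (norm (\<phi> t - \<phi> s) + norm (f t - f s))"
        by (simp add: algebra_simps)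
    qed (use p f M in \<open>auto simp: has_H1_deriv_def\<close>)
    show "(\<lambda>t. \<phi> t *\<^sub>R f' t + \<phi>' t *\<^sub>R f t) \<in> L2_space \<tau>"
    proof (rule L2_space_add)
      show "(\<lambda>t. \<phi> t *\<^sub>R f' t) \<in> L2_space \<tau>"
        using f M cp by (intro L2_space_bounded_scaleR[where M=M] continuous_imp_measurable_on_sets_lebesgue)
          (auto simp: has_H1_deriv_def)
      have p2: "\<phi>' \<in> L2_space \<tau>" using p by (simp add: has_H1_deriv_def)
      have fm: "f \<in> borel_measurable (lebesgue_on {0..\<tau>})"
        using cf by (intro continuous_imp_measurable_on_sets_lebesgue) auto
      show "(\<lambda>t. \<phi>' t *\<^sub>R f t) \<in> L2_space \<tau>"
        unfolding L2_space_iff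
      proof (intro conjI)
        show m: "(\<lambda>t. \<phi>' t *\<^sub>R f t) \<in> borel_measurable (lebesgue_on {0..\<tau>})"
          using p2 fm by measurable
        have "(\<lambda>t. norm (f t) *\<^sub>R \<phi>' t) \<in> L2_space \<tau>"
          using fm M by (intro L2_space_bounded_scaleR[OF p2, where M=M]) auto
        then show "integrable (lebesgue_on {0..\<tau>}) (\<lambda>t. (norm (\<phi>' t *\<^sub>R f t))\<^sup>2)"
          by (simp add: L2_space_iff power_mult_distrib mult.commute)
      qed
    qed
    have "AE t in lebesgue_on {0..\<tau>}. (\<phi> has_vector_derivative \<phi>' t) (at t within {0..\<tau>})"
      "AE t in lebesgue_on {0..\<tau>}. (f has_vector_derivative f' t) (at t within {0..\<tau>})"
      using p f by (auto simp: has_H1_deriv_def)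
    then show "AE t in lebesgue_on {0..\<tau>}. ((\<lambda>t. \<phi> t *\<^sub>R f t) has_vector_derivative
        \<phi> t *\<^sub>R f' t + \<phi>' t *\<^sub>R f t) (at t within {0..\<tau>})"
      by eventually_elim (intro has_vector_derivative_scaleR, auto simp: has_real_derivative_iff_has_vector_derivative)
  qed
qed

text \<open>
  A continuous derivative is bounded on the compact interval, so the function is Lipschitz, that is,
  dominated by the identity.
\<close>
lemma has_H1_deriv_C1:
  fixes f :: "real \<Rightarrow> 'a::euclidean_space"
  assumes der: "\<And>t. t \<in> {0..\<tau>} \<Longrightarrow> (f has_vector_derivative g t) (at t within {0..\<tau>})"
    and g: "continuous_on {0..\<tau>} g"
  shows "has_H1_deriv \<tau> f g"
  unfolding has_H1_deriv_def
proof (intro conjI)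
  obtain M where M: "M \<ge> 0" "\<And>t. t \<in> {0..\<tau>} \<Longrightarrow> norm (g t) \<le> M"
    using continuous_on_interval_bound[OF g] by blast
  show "abs_continuous_on {0..\<tau>} f"
  proof (rule abs_continuous_on_combine[OF abs_continuous_on_id abs_continuous_on_id M(1)])
    fix s t assume "s \<in> {0..\<tau>}" "t \<in> {0..\<tau>}"
    then have "norm (f t - f s) \<le> M * norm (t - s)"
      using der M(2) unfolding has_vector_derivative_def
      by (intro differentiable_bound[of "{0..\<tau>}" f "\<lambda>t h. h *\<^sub>R g t"] onorm_le)
        (auto simp: mult.commute[of M] intro: mult_left_mono)
    also have "\<dots> \<le> M * (norm (t - s) + norm (t - s))" using M(1) by (intro mult_left_mono) auto
    finally show "norm (f t - f s) \<le> M * (norm (t - s) + norm (t - s))" .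
  qed
  show "g \<in> L2_space \<tau>" using g by (rule continuous_on_imp_L2_space)
  show "AE t in lebesgue_on {0..\<tau>}. (f has_vector_derivative g t) (at t within {0..\<tau>})"
    using der by (intro AE_I2) auto
qed

section \<open>The Hilbert space of functions vanishing at both ends\<close>

lemma H10_space_has_H1_deriv: "\<phi> \<in> H10_space \<tau> \<Longrightarrow> has_H1_deriv \<tau> \<phi> (deriv_on \<tau> \<phi>)"
  by (simp add: H10_space_def H1_space_has_H1_deriv)

lemma H10_spaceI:
  assumes "\<tau> > 0" "has_H1_deriv \<tau> \<phi> \<phi>'" "\<phi> 0 = 0" "\<phi> \<tau> = 0" "\<And>t. t \<notin> {0..\<tau>} \<Longrightarrow> \<phi> t = 0"
  shows "\<phi> \<in> H10_space \<tau>"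
  using assms has_H1_deriv_imp_H1_space unfolding H10_space_def by blast

lemma deriv_on_L2_space: "\<phi> \<in> H10_space \<tau> \<Longrightarrow> deriv_on \<tau> \<phi> \<in> L2_space \<tau>"
  using H10_space_has_H1_deriv by (auto simp: has_H1_deriv_def)

lemma H10_space_continuous_on: "\<phi> \<in> H10_space \<tau> \<Longrightarrow> continuous_on {0..\<tau>} \<phi>"
  using H10_space_has_H1_deriv has_H1_deriv_continuous_on by blast

lemma H10_space_L2_space: "\<phi> \<in> H10_space \<tau> \<Longrightarrow> \<phi> \<in> L2_space \<tau>"
  by (rule continuous_on_imp_L2_space[OF H10_space_continuous_on])

lemma H10_space_add_has_H1_deriv:
  assumes "\<phi> \<in> H10_space \<tau>" "\<psi> \<in> H10_space \<tau>"
  shows "has_H1_deriv \<tau> (\<lambda>t. \<phi> t + \<psi> t) (\<lambda>t. deriv_on \<tau> \<phi> t + deriv_on \<tau> \<psi> t)"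
  using assms by (intro has_H1_deriv_add H10_space_has_H1_deriv)

lemma H10_space_scale_has_H1_deriv:
  assumes "\<phi> \<in> H10_space \<tau>"
  shows "has_H1_deriv \<tau> (\<lambda>t. c * \<phi> t) (\<lambda>t. c * deriv_on \<tau> \<phi> t)"
proof -
  have "has_H1_deriv \<tau> (\<lambda>_. c) (\<lambda>_. 0)" by (rule has_H1_deriv_C1) auto
  from has_H1_deriv_scaleR[OF this H10_space_has_H1_deriv[OF assms]] show ?thesis by simp
qed

lemma H10_space_add:
  assumes "\<tau> > 0" "\<phi> \<in> H10_space \<tau>" "\<psi> \<in> H10_space \<tau>"
  shows "(\<lambda>t. \<phi> t + \<psi> t) \<in> H10_space \<tau>"
  using assms by (intro H10_spaceI[OF _ H10_space_add_has_H1_deriv]) (auto simp: H10_space_def)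

lemma H10_space_scale:
  assumes "\<tau> > 0" "\<phi> \<in> H10_space \<tau>"
  shows "(\<lambda>t. c * \<phi> t) \<in> H10_space \<tau>"
  using assms by (intro H10_spaceI[OF _ H10_space_scale_has_H1_deriv]) (auto simp: H10_space_def)

lemma H10_space_zero: "\<tau> > 0 \<Longrightarrow> (\<lambda>_. 0) \<in> H10_space \<tau>"
  by (rule H10_spaceI[where \<phi>' = "\<lambda>_. 0"]) (auto intro: has_H1_deriv_C1)

text \<open>
  Functions on the reals carry no vector space structure here, so linearity is spelled out pointwise.
  The codomain is general because the same notion serves operators, functionals and pairs of operators.
\<close>
definition H10_linear :: "real \<Rightarrow> ((real \<Rightarrow> real) \<Rightarrow> 'a::real_vector) \<Rightarrow> bool" where
  "H10_linear \<tau> T \<longleftrightarrow>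
     (\<forall>\<phi>\<in>H10_space \<tau>. \<forall>\<psi>\<in>H10_space \<tau>. T (\<lambda>t. \<phi> t + \<psi> t) = T \<phi> + T \<psi>) \<and>
     (\<forall>c. \<forall>\<phi>\<in>H10_space \<tau>. T (\<lambda>t. c * \<phi> t) = c *\<^sub>R T \<phi>)"

lemma H10_linearD:
  assumes "H10_linear \<tau> T"
  shows "\<lbrakk>\<phi> \<in> H10_space \<tau>; \<psi> \<in> H10_space \<tau>\<rbrakk> \<Longrightarrow> T (\<lambda>t. \<phi> t + \<psi> t) = T \<phi> + T \<psi>"
    and "\<phi> \<in> H10_space \<tau> \<Longrightarrow> T (\<lambda>t. c * \<phi> t) = c *\<^sub>R T \<phi>"
  using assms by (auto simp: H10_linear_def)

lemma H10_linear_deriv_pairing: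
  fixes f :: "real \<Rightarrow> 'a::euclidean_space"
  assumes "\<tau> > 0" and f: "f \<in> L2_space \<tau>"
  shows "H10_linear \<tau> (\<lambda>\<phi>. LINT t|lebesgue_on {0..\<tau>}. deriv_on \<tau> \<phi> t *\<^sub>R f t)"
proof -
  let ?L = "lebesgue_on {0..\<tau>}"
  have d: "(LINT t|?L. deriv_on \<tau> \<phi> t *\<^sub>R f t) = (LINT t|?L. g t *\<^sub>R f t)"
    if "has_H1_deriv \<tau> \<phi> g" for \<phi> g
  proof (rule integral_cong_AE)
    have ae: "AE t in ?L. deriv_on \<tau> \<phi> t = g t" by (rule has_H1_deriv_deriv_on[OF assms(1) that])
    have g: "g \<in> L2_space \<tau>" using that by (simp add: has_H1_deriv_def)
    have dl: "deriv_on \<tau> \<phi> \<in> L2_space \<tau>"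
      by (rule L2_space_cong_AE[OF g]) (use ae in \<open>auto elim: eventually_mono\<close>)
    show "(\<lambda>t. g t *\<^sub>R f t) \<in> borel_measurable ?L" "(\<lambda>t. deriv_on \<tau> \<phi> t *\<^sub>R f t) \<in> borel_measurable ?L"
      using g dl f by measurable
    show "AE t in ?L. deriv_on \<tau> \<phi> t *\<^sub>R f t = g t *\<^sub>R f t" using ae by (auto elim: eventually_mono)
  qed
  have i: "integrable ?L (\<lambda>t. deriv_on \<tau> \<phi> t *\<^sub>R f t)" if "\<phi> \<in> H10_space \<tau>" for \<phi>
    using that f by (intro L2_space_scaleR_integrable deriv_on_L2_space)
  show ?thesis
    unfolding H10_linear_def
    by (auto simp: d[OF H10_space_add_has_H1_deriv] d[OF H10_space_scale_has_H1_deriv] scaleR_add_left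
        Bochner_Integration.integral_add[OF i i] scaleR_scaleR[symmetric] simp del: scaleR_scaleR)
qed

lemma H10_linear_diff_synthesis:
  assumes "\<tau> > 0" "f \<in> L2_space \<tau>"
  shows "H10_linear \<tau> (diff_synthesis \<tau> f)"
  using H10_linear_deriv_pairing[OF assms] by (simp add: H10_linear_def diff_synthesis_def)

lemma H10_linear_synthesis:
  assumes f: "f \<in> L2_space \<tau>"
  shows "H10_linear \<tau> (synthesis \<tau> f)"
proof -
  have i: "integrable (lebesgue_on {0..\<tau>}) (\<lambda>t. \<phi> t *\<^sub>R f t)" if "\<phi> \<in> H10_space \<tau>" for \<phi>
    using that f by (intro L2_space_scaleR_integrable H10_space_L2_space)
  show ?thesis
    by (auto simp: H10_linear_def synthesis_def scaleR_add_left Bochner_Integration.integral_add[OF i i]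
        scaleR_scaleR[symmetric] simp del: scaleR_scaleR)
qed

lemma H10_inner_commute: "H10_inner \<tau> \<phi> \<psi> = H10_inner \<tau> \<psi> \<phi>"
  by (simp add: H10_inner_def mult.commute)

lemma H10_linear_inner:
  assumes "\<tau> > 0" "\<psi> \<in> H10_space \<tau>"
  shows "H10_linear \<tau> (\<lambda>\<phi>. H10_inner \<tau> \<phi> \<psi>)" "H10_linear \<tau> (\<lambda>\<phi>. H10_inner \<tau> \<psi> \<phi>)"
  using H10_linear_deriv_pairing[OF assms(1) deriv_on_L2_space[OF assms(2)]]
  by (simp_all add: H10_inner_def[abs_def] mult.commute)

text \<open>
  The derivative vanishes almost everywhere, and the fundamental theorem recovers the function from it.
  Absolute continuity is essential here: the Cantor function has derivative zero almost everywhere.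
\<close>
lemma H10_inner_eq_0D:
  assumes "\<tau> > 0" and phi: "\<phi> \<in> H10_space \<tau>" and z: "H10_inner \<tau> \<phi> \<phi> = 0"
  shows "\<phi> = (\<lambda>_. 0)"
proof
  fix s
  let ?L = "lebesgue_on {0..\<tau>}"
  have dl: "deriv_on \<tau> \<phi> \<in> L2_space \<tau>" using phi by (rule deriv_on_L2_space)
  have "integrable ?L (\<lambda>t. deriv_on \<tau> \<phi> t * deriv_on \<tau> \<phi> t)"
    using L2_space_scaleR_integrable[OF dl dl] by simp
  from integral_nonneg_eq_0_iff_AE[OF this] z
  have ae: "AE t in ?L. deriv_on \<tau> \<phi> t = 0" by (simp add: H10_inner_def)
  have h0: "has_H1_deriv \<tau> \<phi> (\<lambda>_. 0)"
    unfolding has_H1_deriv_def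
  proof (intro conjI)
    have h: "has_H1_deriv \<tau> \<phi> (deriv_on \<tau> \<phi>)" by (rule H10_space_has_H1_deriv[OF phi])
    then show "abs_continuous_on {0..\<tau>} \<phi>" by (simp add: has_H1_deriv_def)
    show "(\<lambda>_. 0) \<in> L2_space \<tau>" by (rule continuous_on_imp_L2_space) auto
    have "AE t in ?L. (\<phi> has_vector_derivative deriv_on \<tau> \<phi> t) (at t within {0..\<tau>})"
      using h by (simp add: has_H1_deriv_def)
    with ae show "AE t in ?L. (\<phi> has_vector_derivative 0) (at t within {0..\<tau>})"
      by eventually_elim simp
  qed
  show "\<phi> s = 0"
  proof (cases "s \<in> {0..\<tau>}")
    case True
    have "((\<lambda>_. 0::real) has_integral \<phi> s - \<phi> 0) {0..s}" by (rule has_H1_deriv_integral[OF h0 True])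
    then have "\<phi> s - \<phi> 0 = 0" using has_integral_0 has_integral_unique by blast
    then show ?thesis using phi by (simp add: H10_space_def)
  qed (use phi in \<open>simp add: H10_space_def\<close>)
qed

lemma H10_inner_ext:
  assumes "\<tau> > 0" "\<psi>1 \<in> H10_space \<tau>" "\<psi>2 \<in> H10_space \<tau>"
    and eq: "\<And>\<phi>. \<phi> \<in> H10_space \<tau> \<Longrightarrow> H10_inner \<tau> \<phi> \<psi>1 = H10_inner \<tau> \<phi> \<psi>2"
  shows "\<psi>1 = \<psi>2"
proof -
  define \<delta> where "\<delta> = (\<lambda>t. \<psi>1 t + (-1) * \<psi>2 t)"
  have m: "(\<lambda>t. (-1) * \<psi>2 t) \<in> H10_space \<tau>" by (rule H10_space_scale[OF assms(1,3)])
  have \<delta>: "\<delta> \<in> H10_space \<tau>" unfolding \<delta>_def by (rule H10_space_add[OF assms(1,2) m])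
  note l = H10_linear_inner(2)[OF assms(1) \<delta>]
  have "H10_inner \<tau> \<delta> (\<lambda>t. \<psi>1 t + (-1) * \<psi>2 t) = H10_inner \<tau> \<delta> \<psi>1 + (-1) *\<^sub>R H10_inner \<tau> \<delta> \<psi>2"
    using H10_linearD(1)[OF l assms(2) m] H10_linearD(2)[OF l assms(3), of "-1"] by presburger
  then have "H10_inner \<tau> \<delta> \<delta> = 0" using eq[OF \<delta>] by (simp add: \<delta>_def)
  from H10_inner_eq_0D[OF assms(1) \<delta> this] show ?thesis
    by (auto simp: \<delta>_def fun_eq_iff algebra_simps)
qed

text \<open>
  The boundary terms in the integral of the derivative of the product disappear.
\<close>
lemma H10_by_parts:
  fixes f :: "real \<Rightarrow> 'a::euclidean_space"
  assumes "\<tau> > 0" and phi: "\<phi> \<in> H10_space \<tau>" and f: "has_H1_deriv \<tau> f f'"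
  shows "(LINT t|lebesgue_on {0..\<tau>}. \<phi> t *\<^sub>R f' t) = - (LINT t|lebesgue_on {0..\<tau>}. deriv_on \<tau> \<phi> t *\<^sub>R f t)"
proof -
  let ?L = "lebesgue_on {0..\<tau>}"
  have fL: "f \<in> L2_space \<tau>" by (rule continuous_on_imp_L2_space[OF has_H1_deriv_continuous_on[OF f]])
  have f'L: "f' \<in> L2_space \<tau>" using f by (simp add: has_H1_deriv_def)
  have i1: "integrable ?L (\<lambda>t. \<phi> t *\<^sub>R f' t)"
    using phi f'L by (intro L2_space_scaleR_integrable H10_space_L2_space)
  have i2: "integrable ?L (\<lambda>t. deriv_on \<tau> \<phi> t *\<^sub>R f t)"
    using phi fL by (intro L2_space_scaleR_integrable deriv_on_L2_space)
  have "(LINT t|?L. \<phi> t *\<^sub>R f' t + deriv_on \<tau> \<phi> t *\<^sub>R f t) = \<phi> \<tau> *\<^sub>R f \<tau> - \<phi> 0 *\<^sub>R f 0"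
    by (rule has_H1_deriv_LINT[OF assms(1) has_H1_deriv_scaleR[OF H10_space_has_H1_deriv[OF phi] f]])
  with phi show ?thesis
    by (simp add: Bochner_Integration.integral_add[OF i1 i2] H10_space_def eq_neg_iff_add_eq_0)
qed

section \<open>Adjoints of the synthesis operators\<close>

lemma indefinite_integral_has_H1_deriv:
  fixes y :: "real \<Rightarrow> real"
  assumes "continuous_on {0..\<tau>} y"
  shows "has_H1_deriv \<tau> (\<lambda>s. integral {0..s} y) y"
  using assms by (intro has_H1_deriv_C1 integral_has_vector_derivative)

text \<open>
  The representer is an antiderivative of \<open>- y\<close>, corrected by a constant slope so that it
  returns to zero at \<open>\<tau>\<close>. The correction is orthogonal to all derivatives of functions
  in the space, because these have mean zero. Continuity of \<open>y\<close> makes the antiderivative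
  continuously differentiable, so it lies in the space by an elementary argument.
\<close>
lemma H10_deriv_pairing_representer:
  fixes y :: "real \<Rightarrow> real"
  assumes "\<tau> > 0" and y: "continuous_on {0..\<tau>} y"
  shows "\<exists>\<psi>\<in>H10_space \<tau>. \<forall>\<phi>\<in>H10_space \<tau>.
     - (LINT t|lebesgue_on {0..\<tau>}. deriv_on \<tau> \<phi> t * y t) = H10_inner \<tau> \<phi> \<psi>"
proof -
  let ?L = "lebesgue_on {0..\<tau>}"
  define c where "c = integral {0..\<tau>} y / \<tau>"
  define d where "d = (\<lambda>t. c - y t)"
  define \<psi> where "\<psi> = (\<lambda>s. if s \<in> {0..\<tau>} then integral {0..s} d else 0)"
  have d: "continuous_on {0..\<tau>} d" unfolding d_def by (intro continuous_intros y)
  have "integral {0..\<tau>} d = \<tau> * c - integral {0..\<tau>} y"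
    unfolding d_def using y assms(1)
    by (subst Henstock_Kurzweil_Integration.integral_diff) (auto intro: integrable_continuous_real)
  then have d0: "integral {0..\<tau>} d = 0" using assms(1) by (simp add: c_def)
  have der: "(\<psi> has_vector_derivative d t) (at t within {0..\<tau>})" if t: "t \<in> {0..\<tau>}" for t
    by (rule has_vector_derivative_transform[OF t _ integral_has_vector_derivative[OF d t]])
       (simp add: \<psi>_def)
  have h: "has_H1_deriv \<tau> \<psi> d" by (rule has_H1_deriv_C1[OF der d])
  have \<psi>: "\<psi> \<in> H10_space \<tau>"
    using assms(1) d0 by (intro H10_spaceI[OF _ h]) (auto simp: \<psi>_def)
  moreover have "- (LINT t|?L. deriv_on \<tau> \<phi> t * y t) = H10_inner \<tau> \<phi> \<psi>" if p: "\<phi> \<in> H10_space \<tau>" for \<phi>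
  proof -
    have p0: "(LINT t|?L. deriv_on \<tau> \<phi> t) = 0"
      using has_H1_deriv_LINT[OF assms(1) H10_space_has_H1_deriv[OF p]] p by (simp add: H10_space_def)
    have i: "integrable ?L (deriv_on \<tau> \<phi>)" "integrable ?L (\<lambda>t. deriv_on \<tau> \<phi> t * y t)"
      using L2_space_integrable[OF deriv_on_L2_space[OF p]]
        L2_space_scaleR_integrable[OF deriv_on_L2_space[OF p] continuous_on_imp_L2_space[OF y]] by auto
    have "H10_inner \<tau> \<phi> \<psi> = (LINT t|?L. deriv_on \<tau> \<phi> t * d t)"
      unfolding H10_inner_def
      by (rule Bochner_Integration.integral_cong) (auto simp: deriv_on_unique[OF assms(1) _ der])
    also have "\<dots> = (LINT t|?L. c * deriv_on \<tau> \<phi> t - deriv_on \<tau> \<phi> t * y t)"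
      by (simp add: d_def algebra_simps)
    also have "\<dots> = - (LINT t|?L. deriv_on \<tau> \<phi> t * y t)"
      using i p0 by simp
    finally show ?thesis by simp
  qed
  ultimately show ?thesis by blast
qed

text \<open>
  The defining property of the adjoint, detached from the definite description in
  \<^const>\<open>H10_adjoint\<close>.
\<close>
definition has_H10_adjoint :: "real \<Rightarrow> ((real \<Rightarrow> real) \<Rightarrow> real ^ 'k) \<Rightarrow> (real ^ 'k \<Rightarrow> (real \<Rightarrow> real)) \<Rightarrow> bool" where
  "has_H10_adjoint \<tau> T S \<longleftrightarrow>
     (\<forall>v. S v \<in> H10_space \<tau> \<and> (\<forall>\<phi>\<in>H10_space \<tau>. T \<phi> \<bullet> v = H10_inner \<tau> \<phi> (S v)))"

lemma has_H10_adjointI: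
  assumes "\<tau> > 0"
    and ex: "\<And>v. \<exists>\<psi>\<in>H10_space \<tau>. \<forall>\<phi>\<in>H10_space \<tau>. T \<phi> \<bullet> v = H10_inner \<tau> \<phi> \<psi>"
  shows "has_H10_adjoint \<tau> T (H10_adjoint \<tau> T)"
  unfolding has_H10_adjoint_def
proof
  fix v
  have "\<exists>!\<psi>. \<psi> \<in> H10_space \<tau> \<and> (\<forall>\<phi>\<in>H10_space \<tau>. T \<phi> \<bullet> v = H10_inner \<tau> \<phi> \<psi>)"
    using ex[of v] by (metis H10_inner_ext[OF assms(1)])
  then show "H10_adjoint \<tau> T v \<in> H10_space \<tau> \<and> (\<forall>\<phi>\<in>H10_space \<tau>. T \<phi> \<bullet> v = H10_inner \<tau> \<phi> (H10_adjoint \<tau> T v))"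
    unfolding H10_adjoint_def by (rule theI')
qed

lemma has_H10_adjoint_diff_synthesis:
  fixes f :: "real \<Rightarrow> real ^ 'k"
  assumes "\<tau> > 0" and f: "continuous_on {0..\<tau>} f"
  shows "has_H10_adjoint \<tau> (diff_synthesis \<tau> f) (H10_adjoint \<tau> (diff_synthesis \<tau> f))"
proof (rule has_H10_adjointI[OF assms(1)])
  fix v :: "real ^ 'k"
  have "continuous_on {0..\<tau>} (\<lambda>t. f t \<bullet> v)" by (intro continuous_intros f)
  from H10_deriv_pairing_representer[OF assms(1) this]
  obtain \<psi> where \<psi>: "\<psi> \<in> H10_space \<tau>" "\<And>\<phi>. \<phi> \<in> H10_space \<tau> \<Longrightarrow>
      - (LINT t|lebesgue_on {0..\<tau>}. deriv_on \<tau> \<phi> t * (f t \<bullet> v)) = H10_inner \<tau> \<phi> \<psi>" by blast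
  have "diff_synthesis \<tau> f \<phi> \<bullet> v = H10_inner \<tau> \<phi> \<psi>" if p: "\<phi> \<in> H10_space \<tau>" for \<phi>
  proof -
    have "integrable (lebesgue_on {0..\<tau>}) (\<lambda>t. deriv_on \<tau> \<phi> t *\<^sub>R f t)"
      using p f by (intro L2_space_scaleR_integrable deriv_on_L2_space continuous_on_imp_L2_space)
    then have "diff_synthesis \<tau> f \<phi> \<bullet> v = - (LINT t|lebesgue_on {0..\<tau>}. (deriv_on \<tau> \<phi> t *\<^sub>R f t) \<bullet> v)"
      by (simp only: diff_synthesis_def inner_minus_left integral_inner_left)
    with \<psi>(2)[OF p] show ?thesis by simp
  qed
  with \<psi>(1) show "\<exists>\<psi>\<in>H10_space \<tau>. \<forall>\<phi>\<in>H10_space \<tau>. diff_synthesis \<tau> f \<phi> \<bullet> v = H10_inner \<tau> \<phi> \<psi>" by blast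
qed

text \<open>
  Integrating by parts turns the pairing with \<open>f\<close> into the pairing of the derivative with an
  antiderivative of \<open>f\<close>, which is continuous again.
\<close>
lemma has_H10_adjoint_synthesis:
  fixes f :: "real \<Rightarrow> real ^ 'k"
  assumes "\<tau> > 0" and f: "continuous_on {0..\<tau>} f"
  shows "has_H10_adjoint \<tau> (synthesis \<tau> f) (H10_adjoint \<tau> (synthesis \<tau> f))"
proof (rule has_H10_adjointI[OF assms(1)])
  fix v :: "real ^ 'k"
  have "continuous_on {0..\<tau>} (\<lambda>t. f t \<bullet> v)" by (intro continuous_intros f)
  from indefinite_integral_has_H1_deriv[OF this]
  obtain y where y: "has_H1_deriv \<tau> y (\<lambda>t. f t \<bullet> v)" by blast
  from H10_deriv_pairing_representer[OF assms(1) has_H1_deriv_continuous_on[OF y]]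
  obtain \<psi> where \<psi>: "\<psi> \<in> H10_space \<tau>" "\<And>\<phi>. \<phi> \<in> H10_space \<tau> \<Longrightarrow>
      - (LINT t|lebesgue_on {0..\<tau>}. deriv_on \<tau> \<phi> t * y t) = H10_inner \<tau> \<phi> \<psi>" by blast
  have "synthesis \<tau> f \<phi> \<bullet> v = H10_inner \<tau> \<phi> \<psi>" if p: "\<phi> \<in> H10_space \<tau>" for \<phi>
  proof -
    have "integrable (lebesgue_on {0..\<tau>}) (\<lambda>t. \<phi> t *\<^sub>R f t)"
      using p f by (intro L2_space_scaleR_integrable H10_space_L2_space continuous_on_imp_L2_space)
    then have "synthesis \<tau> f \<phi> \<bullet> v = (LINT t|lebesgue_on {0..\<tau>}. (\<phi> t *\<^sub>R f t) \<bullet> v)"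
      by (simp only: synthesis_def integral_inner_left)
    with \<psi>(2)[OF p] H10_by_parts[OF assms(1) p y] show ?thesis by simp
  qed
  with \<psi>(1) show "\<exists>\<psi>\<in>H10_space \<tau>. \<forall>\<phi>\<in>H10_space \<tau>. synthesis \<tau> f \<phi> \<bullet> v = H10_inner \<tau> \<phi> \<psi>" by blast
qed

lemma linear_comp_H10_linear:
  assumes "H10_linear \<tau> T" "\<And>v. S v \<in> H10_space \<tau>"
    "\<And>v w. S (v + w) = (\<lambda>t. S v t + S w t)" "\<And>c v. S (c *\<^sub>R v) = (\<lambda>t. c * S v t)"
  shows "linear (\<lambda>v. T (S v))"
  using assms by (intro linearI) (auto simp: H10_linear_def)

text \<open>
  On a finite-dimensional domain boundedness is automatic: the inner product pulls back to a bilinear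
  form, which is bounded.
\<close>
lemma H10_bounded_linearI:
  fixes S :: "real ^ 'k \<Rightarrow> real \<Rightarrow> real"
  assumes "\<tau> > 0" and S: "\<And>v. S v \<in> H10_space \<tau>"
    "\<And>v w. S (v + w) = (\<lambda>t. S v t + S w t)" "\<And>c v. S (c *\<^sub>R v) = (\<lambda>t. c * S v t)"
  shows "H10_bounded_linear \<tau> S"
proof -
  have "bilinear (\<lambda>v w. H10_inner \<tau> (S v) (S w))"
    unfolding bilinear_def
    using H10_linear_inner[OF assms(1) S(1)] by (auto intro!: linear_comp_H10_linear[OF _ S])
  then obtain B where B: "\<And>v w. norm (H10_inner \<tau> (S v) (S w)) \<le> B * norm v * norm w" "B > 0"
    using bilinear_bounded_pos by blast
  have "H10_norm \<tau> (S v) \<le> sqrt B * norm v" for v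
  proof -
    have "H10_inner \<tau> (S v) (S v) \<le> B * norm v * norm v" using B(1)[of v v] by simp
    then have "H10_norm \<tau> (S v) \<le> sqrt (B * norm v * norm v)"
      unfolding H10_norm_def by (rule real_sqrt_le_mono)
    then show ?thesis using B(2) by (simp add: real_sqrt_mult mult.assoc)
  qed
  with S show ?thesis unfolding H10_bounded_linear_def by blast
qed

lemma H10_bounded_linearD:
  assumes "H10_bounded_linear \<tau> S"
  shows "S v \<in> H10_space \<tau>" "S (v + w) = (\<lambda>t. S v t + S w t)" "S (c *\<^sub>R v) = (\<lambda>t. c * S v t)"
  using assms by (auto simp: H10_bounded_linear_def)

lemma linear_H10_comp:
  assumes "H10_linear \<tau> T" "H10_bounded_linear \<tau> S"
  shows "linear (T \<circ> S)"
  using linear_comp_H10_linear[OF assms(1) H10_bounded_linearD[OF assms(2)]] by (simp add: o_def)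

lemma has_H10_adjointD:
  assumes "has_H10_adjoint \<tau> T S"
  shows "S v \<in> H10_space \<tau>" "\<phi> \<in> H10_space \<tau> \<Longrightarrow> H10_inner \<tau> \<phi> (S v) = T \<phi> \<bullet> v"
  using assms by (auto simp: has_H10_adjoint_def)

text \<open>
  Linearity follows from uniqueness of the representing function.
\<close>
lemma has_H10_adjoint_bounded_linear:
  assumes "\<tau> > 0" and adj: "has_H10_adjoint \<tau> T S"
  shows "H10_bounded_linear \<tau> S"
proof (rule H10_bounded_linearI[OF assms(1)])
  note S = has_H10_adjointD(1)[OF adj] and in_S = has_H10_adjointD(2)[OF adj]
  show "S v \<in> H10_space \<tau>" for v by (rule S)
  show "S (v + w) = (\<lambda>t. S v t + S w t)" for v w
  proof (rule H10_inner_ext[OF assms(1) S H10_space_add[OF assms(1) S S]])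
    fix \<phi> assume p: "\<phi> \<in> H10_space \<tau>"
    show "H10_inner \<tau> \<phi> (S (v + w)) = H10_inner \<tau> \<phi> (\<lambda>t. S v t + S w t)"
      by (simp add: H10_linearD(1)[OF H10_linear_inner(2)[OF assms(1) p] S S] in_S[OF p] inner_add_right)
  qed
  show "S (c *\<^sub>R v) = (\<lambda>t. c * S v t)" for c v
  proof (rule H10_inner_ext[OF assms(1) S H10_space_scale[OF assms(1) S]])
    fix \<phi> assume p: "\<phi> \<in> H10_space \<tau>"
    show "H10_inner \<tau> \<phi> (S (c *\<^sub>R v)) = H10_inner \<tau> \<phi> (\<lambda>t. c * S v t)"
      by (simp add: H10_linearD(2)[OF H10_linear_inner(2)[OF assms(1) p] S] in_S[OF p])
  qed
qed

text \<open>
  Integration by parts moves the derivative from the test function to \<open>x\<close>, where the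
  differential equation can be used. Thus \<open>X\<^sub>d = A X + B U\<close> for every system that is
  compatible with the data. This is all that the direction from operators to feedback needs.
\<close>
lemma diff_synthesis_eq_of_compatible:
  fixes x :: "real \<Rightarrow> real ^ 'n" and u :: "real \<Rightarrow> real ^ 'm"
  assumes "\<tau> > 0" and D: "(x, u) \<in> data_space \<tau>" and AB: "(A, B) \<in> compatible_systems \<tau> (x, u)"
    and phi: "\<phi> \<in> H10_space \<tau>"
  shows "diff_synthesis \<tau> x \<phi> = A *v synthesis \<tau> x \<phi> + B *v synthesis \<tau> u \<phi>"
proof -
  let ?L = "lebesgue_on {0..\<tau>}"
  have x: "x \<in> H1_space \<tau>" and u: "u \<in> L2_space \<tau>" using D by (auto simp: data_space_def)
  have xL: "x \<in> L2_space \<tau>"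
    using continuous_on_imp_L2_space has_H1_deriv_continuous_on H1_space_has_H1_deriv[OF x] by blast
  have bl: "bounded_linear ((*v) A)" "bounded_linear ((*v) B)"
    by (auto intro: matrix_vector_mul_bounded_linear)
  have L: "(\<lambda>t. A *v x t) \<in> L2_space \<tau>" "(\<lambda>t. B *v u t) \<in> L2_space \<tau>"
    using L2_space_bounded_linear[OF xL bl(1)] L2_space_bounded_linear[OF u bl(2)] .
  have h: "has_H1_deriv \<tau> x (\<lambda>t. A *v x t + B *v u t)"
    using x AB L by (auto simp: has_H1_deriv_def H1_space_def compatible_systems_def intro: L2_space_add)
  have ix: "integrable ?L (\<lambda>t. \<phi> t *\<^sub>R x t)" and iu: "integrable ?L (\<lambda>t. \<phi> t *\<^sub>R u t)"
    using phi xL u by (auto intro: L2_space_scaleR_integrable H10_space_L2_space)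
  have "diff_synthesis \<tau> x \<phi> = (LINT t|?L. \<phi> t *\<^sub>R (A *v x t + B *v u t))"
    unfolding diff_synthesis_def by (rule H10_by_parts[OF assms(1) phi h, symmetric])
  also have "\<dots> = (LINT t|?L. A *v (\<phi> t *\<^sub>R x t) + B *v (\<phi> t *\<^sub>R u t))"
    by (simp add: scaleR_add_right matrix_vector_mult_scaleR)
  also have "\<dots> = (LINT t|?L. A *v (\<phi> t *\<^sub>R x t)) + (LINT t|?L. B *v (\<phi> t *\<^sub>R u t))"
    by (intro Bochner_Integration.integral_add integrable_bounded_linear[OF bl(1) ix] integrable_bounded_linear[OF bl(2) iu])
  also have "\<dots> = A *v synthesis \<tau> x \<phi> + B *v synthesis \<tau> u \<phi>"
    by (simp only: synthesis_def integral_bounded_linear[OF bl(1) ix] integral_bounded_linear[OF bl(2) iu])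
  finally show ?thesis .
qed

section \<open>The fundamental lemma of the calculus of variations\<close>

text \<open>
  The sets over which \<open>h\<close> has zero integral include the closed intervals and are closed under
  complements and countable disjoint unions, so they include all Borel sets. Every Lebesgue set is a Borel
  set up to a null set.
\<close>
lemma AE_eq_0_if_interval_integrals_eq_0:
  fixes h :: "real \<Rightarrow> real"
  assumes h: "integrable (lebesgue_on {c..d}) h"
    and int: "\<And>a b. a \<le> b \<Longrightarrow> (LINT t|lebesgue_on {c..d}. indicat_real {a..b} t * h t) = 0"
  shows "AE t in lebesgue_on {c..d}. h t = 0"
proof -
  let ?L = "lebesgue_on {c..d}"
  interpret finite_measure ?L by (rule finite_measure_lebesgue_on) simp
  have sets: "S \<inter> {c..d} \<in> sets ?L" if "S \<in> sets lebesgue" for S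
    using that by (auto simp: sets_restrict_space)
  have si: "set_integrable ?L (S \<inter> {c..d}) h" if "S \<in> sets lebesgue" for S
    unfolding set_integrable_def using integrable_mult_indicator[OF sets[OF that] h] .
  have borel: "(LINT t:S \<inter> {c..d}|?L. h t) = 0" if "S \<in> sets borel" for S
    using that
  proof (induction rule: borel_set_induct)
    case empty
    show ?case by (simp add: set_lebesgue_integral_def)
  next
    case (interval a b)
    have "(LINT t:{a..b} \<inter> {c..d}|?L. h t) = (LINT t|?L. indicat_real {a..b} t * h t)"
      unfolding set_lebesgue_integral_def by (rule Bochner_Integration.integral_cong) (auto simp: indicator_def)
    then show ?case using int[OF interval] by simp
  next
    case (compl A)
    have "(LINT t:UNIV \<inter> {c..d}|?L. h t) = (LINT t|?L. indicat_real {min c d..max c d} t * h t)"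
      unfolding set_lebesgue_integral_def by (rule Bochner_Integration.integral_cong) (auto simp: indicator_def)
    then have "(LINT t:UNIV \<inter> {c..d}|?L. h t) = 0" using int[of "min c d" "max c d"] by simp
    moreover have "UNIV \<inter> {c..d} = (A \<inter> {c..d}) \<union> (- A \<inter> {c..d})" by blast
    moreover have "(LINT t:(A \<inter> {c..d}) \<union> (- A \<inter> {c..d})|?L. h t) =
        (LINT t:A \<inter> {c..d}|?L. h t) + (LINT t:- A \<inter> {c..d}|?L. h t)"
      using compl by (intro set_integral_Un si) auto
    ultimately show ?case using compl by simp
  next
    case (union f)
    have eq: "(\<Union>i. f i) \<inter> {c..d} = (\<Union>i. f i \<inter> {c..d})" by blast
    have fl: "f i \<in> sets lebesgue" for i using union(2)[of i] by simp
    then have "set_integrable ?L (\<Union>i. f i \<inter> {c..d}) h"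
      unfolding eq[symmetric] by (intro si sets.countable_UN) auto
    moreover have "f i \<inter> {c..d} \<inter> (f j \<inter> {c..d}) = {}" if "i \<noteq> j" for i j
      using union(1) that unfolding disjoint_family_on_def by blast
    ultimately have "(LINT t:(\<Union>i. f i \<inter> {c..d})|?L. h t) = (\<Sum>i. (LINT t:f i \<inter> {c..d}|?L. h t))"
      using sets[OF fl] by (intro lebesgue_integral_countable_add)
    with union(3) show ?case by (simp only: eq suminf_zero)
  qed
  show ?thesis
  proof (rule density_zero[OF h])
    fix A assume AL: "A \<in> sets ?L"
    then have "A \<in> sets lebesgue" "A \<subseteq> {c..d}" by (auto simp: sets_restrict_space)
    then obtain S N N' where A: "A = S \<union> N" "N \<subseteq> N'" "N' \<in> null_sets lborel" "S \<in> sets lborel"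
      by (auto elim: sets_completionE)
    have "AE t in lebesgue. t \<notin> N'" using A(3) by (intro AE_completion AE_not_in)
    then have "AE t in ?L. t \<notin> N'" by (subst AE_restrict_space_iff) (auto elim: eventually_mono)
    then have "AE t in ?L. indicat_real A t *\<^sub>R h t = indicat_real (S \<inter> {c..d}) t *\<^sub>R h t"
      by eventually_elim (use A \<open>A \<subseteq> {c..d}\<close> in \<open>auto simp: indicator_def\<close>)
    then have "(LINT t:A|?L. h t) = (LINT t:S \<inter> {c..d}|?L. h t)"
      unfolding set_lebesgue_integral_def
      using h AL sets[of S] A(4)
      by (intro integral_cong_AE) (auto intro!: borel_measurable_scaleR borel_measurable_indicator)
    with borel A(4) show "(LINT t:A|?L. h t) = 0" by simp
  qed
qed

text \<open>
  The factor \<open>t (\<tau> - t)\<close> enforces the boundary values. The logistic factor is smooth, and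
  since \<open>(t - a) (b - t)\<close> is positive exactly between \<open>a\<close> and \<open>b\<close>, it
  tends to the indicator of that interval.
\<close>
definition sigmoid_bump :: "real \<Rightarrow> real \<Rightarrow> real \<Rightarrow> nat \<Rightarrow> real \<Rightarrow> real" where
  "sigmoid_bump \<tau> a b n t = (if t \<in> {0..\<tau>} then t * (\<tau> - t) / (1 + exp (- real n * ((t - a) * (b - t)))) else 0)"

lemma sigmoid_bump_H10_space:
  assumes "\<tau> > 0"
  shows "sigmoid_bump \<tau> a b n \<in> H10_space \<tau>"
proof -
  define E where "E = (\<lambda>t::real. exp (- real n * ((t - a) * (b - t))))"
  define E' where "E' = (\<lambda>t::real. E t * (- real n * (b - t - (t - a))))"
  have E: "(E has_real_derivative E' t) (at t)" for t
    unfolding E_def E'_def by (auto intro!: derivative_eq_intros)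
  have Epos: "1 + E t \<noteq> 0" for t unfolding E_def using exp_gt_zero by (smt (verit))
  define s' where "s' = (\<lambda>t. ((\<tau> - 2 * t) * (1 + E t) - t * (\<tau> - t) * E' t) / ((1 + E t) * (1 + E t)))"
  have der: "((\<lambda>t. t * (\<tau> - t) / (1 + E t)) has_real_derivative s' t) (at t within {0..\<tau>})" for t
    unfolding s'_def
    by (rule DERIV_subset[of _ _ _ UNIV]) (auto intro!: derivative_eq_intros E Epos simp: algebra_simps)
  have d: "(sigmoid_bump \<tau> a b n has_vector_derivative s' t) (at t within {0..\<tau>})" if t: "t \<in> {0..\<tau>}" for t
    by (rule has_vector_derivative_transform[OF t _ der[unfolded has_real_derivative_iff_has_vector_derivative]])
       (simp add: sigmoid_bump_def E_def)
  have cE: "continuous_on {0..\<tau>} E" unfolding E_def by (intro continuous_intros)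
  have "continuous_on {0..\<tau>} s'"
    unfolding s'_def E'_def by (intro continuous_intros cE) (auto simp: Epos)
  from has_H1_deriv_C1[OF d this] show ?thesis
    using assms by (intro H10_spaceI) (auto simp: sigmoid_bump_def)
qed

lemma sigmoid_bump_abs_le:
  assumes "t \<in> {0..\<tau>}"
  shows "\<bar>sigmoid_bump \<tau> a b n t\<bar> \<le> t * (\<tau> - t)"
proof -
  have "0 \<le> t * (\<tau> - t)" using assms by simp
  moreover have "1 \<le> 1 + exp (- real n * ((t - a) * (b - t)))" by simp
  ultimately have "t * (\<tau> - t) / (1 + exp (- real n * ((t - a) * (b - t)))) \<le> t * (\<tau> - t) / 1"
    by (intro divide_left_mono) (auto intro: add_pos_pos)
  with \<open>0 \<le> t * (\<tau> - t)\<close> assms show ?thesis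
    by (auto simp: sigmoid_bump_def abs_mult add_pos_pos)
qed

lemma sigmoid_bump_tendsto:
  assumes t: "t \<in> {0..\<tau>}" and ab: "a \<le> b" "t \<noteq> a" "t \<noteq> b"
  shows "(\<lambda>n. sigmoid_bump \<tau> a b n t) \<longlonglongrightarrow> indicat_real {a..b} t * (t * (\<tau> - t))"
proof -
  define q where "q = (t - a) * (b - t)"
  have eq: "sigmoid_bump \<tau> a b n t = t * (\<tau> - t) / (1 + exp (- q * real n))" for n
    using t by (simp add: sigmoid_bump_def q_def mult.commute)
  show ?thesis
  proof (cases "t \<in> {a..b}")
    case True
    with ab have q: "q > 0" by (auto simp: q_def)
    have "(\<lambda>n. exp (- q * real n)) \<longlonglongrightarrow> 0"
      using q by real_asymp
    then have "(\<lambda>n. t * (\<tau> - t) / (1 + exp (- q * real n))) \<longlonglongrightarrow> t * (\<tau> - t) / (1 + 0)"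
      by (intro tendsto_intros) auto
    with True show ?thesis by (simp add: eq)
  next
    case False
    with ab have q: "q < 0" by (auto simp: q_def mult_less_0_iff)
    have "(\<lambda>n. inverse (1 + exp (- q * real n))) \<longlonglongrightarrow> 0"
      using q by real_asymp
    then have "(\<lambda>n. t * (\<tau> - t) * inverse (1 + exp (- q * real n))) \<longlonglongrightarrow> t * (\<tau> - t) * 0"
      by (intro tendsto_intros)
    with False show ?thesis by (simp add: eq divide_inverse)
  qed
qed

text \<open>
  Testing with the logistic bumps and letting \<open>n\<close> tend to infinity shows that
  \<open>t (\<tau> - t) g(t)\<close> has zero integral over every interval.
\<close>
lemma AE_eq_0_if_orthogonal_to_H10_space:
  fixes g :: "real \<Rightarrow> real"
  assumes "\<tau> > 0" and g: "g \<in> L2_space \<tau>"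
    and orth: "\<And>\<phi>. \<phi> \<in> H10_space \<tau> \<Longrightarrow> (LINT t|lebesgue_on {0..\<tau>}. \<phi> t * g t) = 0"
  shows "AE t in lebesgue_on {0..\<tau>}. g t = 0"
proof -
  let ?L = "lebesgue_on {0..\<tau>}"
  define w where "w = (\<lambda>t. t * (\<tau> - t))"
  have wL: "w \<in> L2_space \<tau>" unfolding w_def by (intro continuous_on_imp_L2_space continuous_intros)
  have wg: "integrable ?L (\<lambda>t. w t * g t)" using L2_space_scaleR_integrable[OF wL g] by simp
  have "AE t in ?L. w t * g t = 0"
  proof (rule AE_eq_0_if_interval_integrals_eq_0[OF wg])
    fix a b :: real assume ab: "a \<le> b"
    have "(\<lambda>n. LINT t|?L. sigmoid_bump \<tau> a b n t * g t) \<longlonglongrightarrow> (LINT t|?L. indicat_real {a..b} t * (w t * g t))"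
    proof (rule integral_dominated_convergence[where w = "\<lambda>t. norm (w t * g t)"])
      have "AE t in lebesgue. t \<noteq> a \<and> t \<noteq> b"
        using AE_lborel_singleton[of a] AE_lborel_singleton[of b] by (intro AE_completion) auto
      then have "AE t in ?L. t \<noteq> a \<and> t \<noteq> b"
        by (subst AE_restrict_space_iff) (auto elim: eventually_mono)
      then show "AE t in ?L. (\<lambda>n. sigmoid_bump \<tau> a b n t * g t) \<longlonglongrightarrow> indicat_real {a..b} t * (w t * g t)"
      proof (rule lebesgue_on_mono)
        fix t assume "t \<noteq> a \<and> t \<noteq> b" "t \<in> {0..\<tau>}"
        with sigmoid_bump_tendsto[of t \<tau> a b] ab
        have "(\<lambda>n. sigmoid_bump \<tau> a b n t) \<longlonglongrightarrow> indicat_real {a..b} t * w t" by (simp add: w_def)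
        from tendsto_mult[OF this tendsto_const[of "g t"]]
        show "(\<lambda>n. sigmoid_bump \<tau> a b n t * g t) \<longlonglongrightarrow> indicat_real {a..b} t * (w t * g t)"
          by (simp add: mult.assoc)
      qed
      show "AE t in ?L. norm (sigmoid_bump \<tau> a b n t * g t) \<le> norm (w t * g t)" for n
      proof (rule AE_I2)
        fix t assume "t \<in> space ?L"
        then have t: "t \<in> {0..\<tau>}" by simp
        then have "\<bar>sigmoid_bump \<tau> a b n t\<bar> \<le> \<bar>w t\<bar>"
          using sigmoid_bump_abs_le[OF t, of a b n] by (simp add: w_def)
        then show "norm (sigmoid_bump \<tau> a b n t * g t) \<le> norm (w t * g t)"
          by (simp add: abs_mult mult_right_mono)
      qed
      have m: "sigmoid_bump \<tau> a b n \<in> borel_measurable ?L" for n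
        using H10_space_L2_space[OF sigmoid_bump_H10_space[OF assms(1)]] by (rule L2_space_measurable)
      show "(\<lambda>t. sigmoid_bump \<tau> a b n t * g t) \<in> borel_measurable ?L" for n
        using m g by measurable
      have "{a..b} \<inter> {0..\<tau>} \<in> sets ?L" by (auto simp: sets_restrict_space)
      then have "indicat_real {a..b} \<in> borel_measurable ?L"
        by (subst borel_measurable_indicator_iff) (auto simp: Int_commute)
      then show "(\<lambda>t. indicat_real {a..b} t * (w t * g t)) \<in> borel_measurable ?L"
        using wL g by measurable
    qed (use wg in simp)
    moreover have "(LINT t|?L. sigmoid_bump \<tau> a b n t * g t) = 0" for n
      by (rule orth[OF sigmoid_bump_H10_space[OF assms(1)]])
    ultimately show "(LINT t|?L. indicat_real {a..b} t * (w t * g t)) = 0" by (simp add: LIMSEQ_const_iff)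
  qed
  moreover have "AE t in lebesgue. t \<noteq> 0 \<and> t \<noteq> \<tau>"
    using AE_lborel_singleton[of 0] AE_lborel_singleton[of \<tau>] by (intro AE_completion) auto
  then have "AE t in ?L. t \<noteq> 0 \<and> t \<noteq> \<tau>"
    by (subst AE_restrict_space_iff) (auto elim: eventually_mono)
  ultimately show ?thesis by eventually_elim (auto simp: w_def)
qed

section \<open>Linear algebra\<close>

definition rank_one :: "real ^ 'n \<Rightarrow> real ^ 'm \<Rightarrow> real ^ 'm ^ 'n" where
  "rank_one w a = (\<chi> i j. w $ i * a $ j)"

lemma rank_one_mult_vec: "rank_one w a *v v = (a \<bullet> v) *\<^sub>R w"
  by (simp add: rank_one_def matrix_vector_mult_def vec_eq_iff inner_vec_def sum_distrib_left mult_ac)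

lemma hurwitz_no_real_fixed_vector:
  assumes "hurwitz M" "M *v v = v"
  shows "v = 0"
proof (rule ccontr)
  assume "v \<noteq> 0"
  define v' :: "complex ^ 'a" where "v' = (\<chi> i. complex_of_real (v $ i))"
  have "v' \<noteq> 0" using \<open>v \<noteq> 0\<close> by (auto simp: v'_def vec_eq_iff)
  have "(\<Sum>j\<in>UNIV. complex_of_real (M $ i $ j) * complex_of_real (v $ j)) = complex_of_real (v $ i)" for i
  proof -
    have "(\<Sum>j\<in>UNIV. complex_of_real (M $ i $ j) * complex_of_real (v $ j)) = complex_of_real ((M *v v) $ i)"
      by (simp add: matrix_vector_mult_def)
    with assms(2) show ?thesis by simp
  qed
  then have "map_matrix complex_of_real M *v v' = 1 *s v'"
    by (simp add: v'_def vec_eq_iff matrix_vector_mult_def)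
  with assms(1) \<open>v' \<noteq> 0\<close> have "Re 1 < 0" unfolding hurwitz_def by blast
  then show False by simp
qed

text \<open>
  If \<open>c\<close> were nonzero, a suitable \<open>w\<close> would turn \<open>c\<close> into an eigenvector
  for the eigenvalue 1.
\<close>
lemma rank_one_perturbation_hurwitz_imp_0:
  fixes M :: "real ^ 'n ^ 'n"
  assumes "\<And>w. hurwitz (M + rank_one w c)"
  shows "c = 0"
proof (rule ccontr)
  assume c: "c \<noteq> 0"
  define w where "w = (1 / (c \<bullet> c)) *\<^sub>R (c - M *v c)"
  have "(M + rank_one w c) *v c = c"
    using c by (simp add: matrix_vector_mult_add_rdistrib rank_one_mult_vec w_def)
  with assms[of w] c show False using hurwitz_no_real_fixed_vector by blast
qed

text \<open>
  The range of a self-adjoint matrix is the orthogonal complement of its kernel, so the hypothesis on the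
  kernel puts every column of \<open>D\<close> into the range of \<open>G\<close>. The columns of
  \<open>H\<close> are preimages of them.
\<close>
lemma selfadjoint_matrix_factorization:
  fixes G D :: "real ^ 'n ^ 'n"
  assumes sym: "\<And>v w. (G *v v) \<bullet> w = v \<bullet> (G *v w)"
    and ker: "\<And>v w. G *v v = 0 \<Longrightarrow> (D *v w) \<bullet> v = 0"
  shows "\<exists>H :: real ^ 'n ^ 'n. G ** H = D"
proof -
  have sub: "subspace (range ((*v) G))"
    by (intro linear_subspace_image subspace_UNIV matrix_vector_mul_linear)
  have ran: "D *v w \<in> range ((*v) G)" for w
  proof -
    have "D *v w \<in> ((range ((*v) G))\<^sup>\<bottom>)\<^sup>\<bottom>"
      unfolding orthogonal_comp_def
    proof safe
      fix v assume v: "\<forall>y\<in>range ((*v) G). orthogonal y v"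
      then have "(G *v (G *v v)) \<bullet> v = 0" by (simp add: orthogonal_def)
      then have "G *v v = 0" using sym[of "G *v v" v] by simp
      from ker[OF this, of w] show "orthogonal v (D *v w)" by (simp add: orthogonal_def inner_commute)
    qed
    then show ?thesis using orthogonal_comp_self[OF sub] by simp
  qed
  then have "\<forall>j. \<exists>h. G *v h = D *v axis j 1" by (metis imageE)
  then obtain h where h: "\<And>j. G *v h j = D *v axis j 1" by metis
  define H :: "real ^ 'n ^ 'n" where "H = (\<chi> i j. h j $ i)"
  have "column j H = h j" for j by (simp add: H_def column_def vec_eq_iff)
  then have "column j (G ** H) = column j D" for j
    by (metis h matrix_vector_mult_basis matrix_vector_mul_assoc)
  then have "G ** H = D" by (simp add: column_def vec_eq_iff)
  then show ?thesis by blast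
qed

lemma invertible_matrix_inv:
  fixes A :: "'a::field ^ 'n ^ 'n"
  assumes "invertible A"
  shows "A ** matrix_inv A = mat 1" "matrix_inv A ** A = mat 1"
  using assms unfolding invertible_def matrix_inv_def by (metis (mono_tags, lifting) someI_ex)+

lemma matrix_H10_comp:
  assumes "H10_linear \<tau> T" "H10_bounded_linear \<tau> S"
  shows "matrix (T \<circ> S) *v v = T (S v)"
  using matrix_vector_mul(2)[OF linear_H10_comp[OF assms]] by (metis comp_apply)

lemma H10_linear_zero:
  assumes "\<tau> > 0" "H10_linear \<tau> T"
  shows "T (\<lambda>_. 0) = 0"
  using H10_linearD(2)[OF assms(2) H10_space_zero[OF assms(1)], of 0] by simp

lemma subspace_H10_linear_range:
  assumes "\<tau> > 0" and T: "H10_linear \<tau> T"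
  shows "subspace (T ` H10_space \<tau>)"
  unfolding subspace_def
proof (intro conjI ballI allI)
  show "0 \<in> T ` H10_space \<tau>"
    using H10_space_zero[OF assms(1)] H10_linear_zero[OF assms] by (metis imageI)
next
  fix a b assume "a \<in> T ` H10_space \<tau>" "b \<in> T ` H10_space \<tau>"
  then obtain \<phi> \<psi> where "\<phi> \<in> H10_space \<tau>" "a = T \<phi>" "\<psi> \<in> H10_space \<tau>" "b = T \<psi>" by blast
  then show "a + b \<in> T ` H10_space \<tau>"
    using H10_linearD(1)[OF T, of \<phi> \<psi>] H10_space_add[OF assms(1), of \<phi> \<psi>] by (metis imageI)
next
  fix c a assume "a \<in> T ` H10_space \<tau>"
  then obtain \<phi> where "\<phi> \<in> H10_space \<tau>" "a = T \<phi>" by blast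
  then show "c *\<^sub>R a \<in> T ` H10_space \<tau>"
    using H10_linearD(2)[OF T, of \<phi> c] H10_space_scale[OF assms(1), of \<phi> c] by (metis imageI)
qed

lemma H10_linear_sum:
  assumes "\<tau> > 0" and T: "H10_linear \<tau> T" and "finite A" and \<phi>: "\<And>i. i \<in> A \<Longrightarrow> \<phi> i \<in> H10_space \<tau>"
  shows "(\<lambda>t. \<Sum>i\<in>A. c i * \<phi> i t) \<in> H10_space \<tau>
     \<and> T (\<lambda>t. \<Sum>i\<in>A. c i * \<phi> i t) = (\<Sum>i\<in>A. c i *\<^sub>R T (\<phi> i))"
  using assms(3) \<phi>
proof (induction A rule: finite_induct)
  case empty
  show ?case using H10_space_zero[OF assms(1)] H10_linear_zero[OF assms(1) T] by simp
next
  case (insert a A)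
  have 1: "(\<lambda>t. c a * \<phi> a t) \<in> H10_space \<tau>" using insert by (intro H10_space_scale assms(1)) auto
  have 2: "(\<lambda>t. \<Sum>i\<in>A. c i * \<phi> i t) \<in> H10_space \<tau>" using insert by auto
  have 3: "T (\<lambda>t. c a * \<phi> a t) = c a *\<^sub>R T (\<phi> a)" using insert by (intro H10_linearD(2)[OF T]) auto
  show ?case
    using insert H10_space_add[OF assms(1) 1 2] H10_linearD(1)[OF T 1 2] 3 by simp
qed

text \<open>
  Preimages of the unit vectors, extended linearly.
\<close>
lemma H10_linear_lift:
  fixes L :: "real ^ 'k \<Rightarrow> 'b::real_vector"
  assumes "\<tau> > 0" and T: "H10_linear \<tau> T" and L: "linear L"
    and ex: "\<And>v. \<exists>\<phi>\<in>H10_space \<tau>. T \<phi> = L v"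
  shows "\<exists>S. H10_bounded_linear \<tau> S \<and> (\<forall>v. T (S v) = L v)"
proof -
  from ex obtain f where f: "\<And>v. f v \<in> H10_space \<tau>" "\<And>v. T (f v) = L v" by metis
  define S where "S = (\<lambda>(v :: real ^ 'k) t. \<Sum>i\<in>UNIV. v $ i * f (axis i 1) t)"
  have "S v \<in> H10_space \<tau>" for v
    unfolding S_def by (rule conjunct1[OF H10_linear_sum[OF assms(1) T]]) (auto intro: f)
  then have "H10_bounded_linear \<tau> S"
    by (intro H10_bounded_linearI assms(1)) (auto simp: S_def sum.distrib distrib_right sum_distrib_left mult.assoc)
  moreover have "T (S v) = L v" for v
  proof -
    have "T (S v) = (\<Sum>i\<in>UNIV. v $ i *\<^sub>R L (axis i 1))"
      unfolding S_def f(2)[symmetric] by (rule conjunct2[OF H10_linear_sum[OF assms(1) T]]) (auto intro: f)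
    also have "\<dots> = L (\<Sum>i\<in>UNIV. v $ i *\<^sub>R axis i 1)"
      using L by (simp add: linear_sum linear_cmul)
    also have "(\<Sum>i\<in>UNIV. v $ i *\<^sub>R axis i 1) = v"
      using basis_expansion[of v] by (simp add: scalar_mult_eq_scaleR)
    finally show ?thesis .
  qed
  ultimately show ?thesis by blast
qed

section \<open>Right inverses of the synthesis operator\<close>

text \<open>
  The equivalence of the last two statements is pure Hilbert space geometry: it holds for any two
  linear operators with adjoints.
\<close>
locale adjoint_pair =
  fixes \<tau> :: real and Xd X :: "(real \<Rightarrow> real) \<Rightarrow> real ^ 'n" and Xd_adj X_adj :: "real ^ 'n \<Rightarrow> real \<Rightarrow> real"
  assumes tau: "\<tau> > 0"
    and Xd: "H10_linear \<tau> Xd" and X: "H10_linear \<tau> X"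
    and Xd_adj: "has_H10_adjoint \<tau> Xd Xd_adj" and X_adj: "has_H10_adjoint \<tau> X X_adj"
begin

abbreviation "W \<equiv> matrix (X \<circ> X_adj)"
abbreviation "Winv \<equiv> matrix_inv W"
abbreviation "N \<equiv> matrix (X \<circ> Xd_adj)"
abbreviation "F \<equiv> matrix (Xd \<circ> X_adj) ** Winv"
abbreviation "G \<equiv> matrix (Xd \<circ> Xd_adj) - matrix (Xd \<circ> X_adj) ** Winv ** N"

lemmas X_adj_linear = has_H10_adjoint_bounded_linear[OF tau X_adj]
lemmas Xd_adj_linear = has_H10_adjoint_bounded_linear[OF tau Xd_adj]

text \<open>
  A kernel vector \<open>v\<close> satisfies \<open>X\<^sup>* v = 0\<close>, since the norm of
  \<open>X\<^sup>* v\<close> squared is \<open>v \<bullet> X X\<^sup>* v\<close>; hence it is orthogonal to the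
  range of \<open>X\<close>.
\<close>
lemma gram_invertible_if_surj:
  assumes "X ` H10_space \<tau> = UNIV"
  shows "invertible W"
  unfolding invertible_left_inverse matrix_left_invertible_ker
proof (intro allI impI)
  fix v assume "W *v v = 0"
  then have "X (X_adj v) = 0" by (simp add: matrix_H10_comp[OF X X_adj_linear])
  then have "H10_inner \<tau> (X_adj v) (X_adj v) = 0"
    using has_H10_adjointD[OF X_adj] by simp
  then have z: "X_adj v = (\<lambda>_. 0)" by (rule H10_inner_eq_0D[OF tau has_H10_adjointD(1)[OF X_adj]])
  from assms obtain \<phi> where p: "\<phi> \<in> H10_space \<tau>" "X \<phi> = v" by (metis UNIV_I imageE)
  have "v \<bullet> v = H10_inner \<tau> \<phi> (X_adj v)" using has_H10_adjointD(2)[OF X_adj p(1)] p(2) by simp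
  also have "\<dots> = H10_inner \<tau> \<phi> (X_adj 0)"
    using z H10_bounded_linearD(3)[OF X_adj_linear, of 0 0] by simp
  also have "\<dots> = 0" using has_H10_adjointD(2)[OF X_adj p(1)] by simp
  finally show "v = 0" by simp
qed

text \<open>
  With \<open>P = I - X\<^sup>* W\<^sup>-\<^sup>1 X\<close>, the orthogonal projection onto the kernel of
  \<open>X\<close> when \<open>W = X X\<^sup>*\<close> is invertible, this is
  \<open>X\<^sup>* W\<^sup>-\<^sup>1 + P X\<^sub>d\<^sup>* H\<close>: the minimum-norm right inverse of
  \<open>X\<close> plus a correction with values in the kernel of \<open>X\<close>.
\<close>
definition lift :: "real ^ 'n ^ 'n \<Rightarrow> real ^ 'n \<Rightarrow> real \<Rightarrow> real" where
  "lift H v = (\<lambda>t. X_adj ((Winv - Winv ** N ** H) *v v) t + Xd_adj (H *v v) t)"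

lemma lift_linear: "H10_bounded_linear \<tau> (lift H)"
  using H10_bounded_linearD[OF X_adj_linear] H10_bounded_linearD[OF Xd_adj_linear]
  by (intro H10_bounded_linearI[OF tau])
     (auto simp: lift_def matrix_vector_right_distrib matrix_vector_mult_scaleR add_ac distrib_left intro!: H10_space_add[OF tau])

text \<open>
  For \<open>T = X\<^sub>d\<close> the right-hand side is \<open>F + G H\<close>, and for \<open>T = U\<close> it is
  the feedback gain of the theorem. The formulas for \<open>F\<close>, \<open>G\<close> and the gain are thus
  instances of a single one.
\<close>
lemma matrix_comp_lift:
  fixes T :: "(real \<Rightarrow> real) \<Rightarrow> real ^ 'k"
  assumes T: "H10_linear \<tau> T"
  shows "matrix (T \<circ> lift H) = matrix (T \<circ> X_adj) ** Winv
     + (matrix (T \<circ> Xd_adj) - matrix (T \<circ> X_adj) ** Winv ** N) ** H"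
  unfolding matrix_eq
proof
  fix v
  have "matrix (T \<circ> lift H) *v v = T (X_adj ((Winv - Winv ** N ** H) *v v)) + T (Xd_adj (H *v v))"
    using H10_linearD(1)[OF T H10_bounded_linearD(1)[OF X_adj_linear] H10_bounded_linearD(1)[OF Xd_adj_linear]]
    by (simp add: matrix_H10_comp[OF T lift_linear] lift_def)
  also have "\<dots> = matrix (T \<circ> X_adj) *v ((Winv - Winv ** N ** H) *v v) + matrix (T \<circ> Xd_adj) *v (H *v v)"
    by (simp only: matrix_H10_comp[OF T X_adj_linear] matrix_H10_comp[OF T Xd_adj_linear])
  also have "\<dots> = (matrix (T \<circ> X_adj) ** Winv
     + (matrix (T \<circ> Xd_adj) - matrix (T \<circ> X_adj) ** Winv ** N) ** H) *v v"
    by (simp add: matrix_vector_mult_add_rdistrib matrix_vector_mult_diff_rdistrib matrix_vector_mult_diff_distrib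
        matrix_vector_mul_assoc[symmetric])
  finally show "matrix (T \<circ> lift H) *v v = (matrix (T \<circ> X_adj) ** Winv
     + (matrix (T \<circ> Xd_adj) - matrix (T \<circ> X_adj) ** Winv ** N) ** H) *v v" .
qed

lemma lift_right_inverse:
  assumes "invertible W"
  shows "H10_right_inverse \<tau> X (lift H)"
  unfolding H10_right_inverse_def
proof (intro conjI allI)
  show "H10_bounded_linear \<tau> (lift H)" by (rule lift_linear)
  have "matrix (X \<circ> lift H) = mat 1"
    unfolding matrix_comp_lift[OF X]
    by (simp add: invertible_matrix_inv[OF assms] matrix_eq matrix_vector_mult_add_rdistrib
        matrix_vector_mult_diff_rdistrib matrix_vector_mul_assoc[symmetric])
  then show "X (lift H v) = v" for v using matrix_H10_comp[OF X lift_linear, of H v] by simp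
qed

text \<open>
  Two right inverses differ by a map into the kernel of \<open>X\<close>, so \<open>X\<^sub>d S - F\<close>
  factors through \<open>X\<^sub>d P\<close>, with \<open>P\<close> the projection onto that kernel.
  As \<open>G = (X\<^sub>d P) (X\<^sub>d P)\<^sup>*\<close> has the same range as \<open>X\<^sub>d P\<close>, the
  difference has the form \<open>G H\<close>. The proof phrases the equality of ranges through kernels, so
  that it takes place in finite dimension.
\<close>
lemma right_inverse_factorization:
  assumes inv: "invertible W" and S: "H10_right_inverse \<tau> X S"
  shows "\<exists>H. F + G ** H = matrix (Xd \<circ> S)"
proof -
  have Sl: "H10_bounded_linear \<tau> S" and XS: "\<And>v. X (S v) = v"
    using S by (auto simp: H10_right_inverse_def)
  \<comment> \<open>The function \<open>q v\<close> is the projection of \<open>X\<^sub>d\<^sup>* v\<close> to the kernel of \<open>X\<close>, and \<open>G\<close> is the Gram matrix of these projections.\<close>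
  define z where "z = (\<lambda>v. Winv *v (N *v v))"
  define q where "q = (\<lambda>v t. Xd_adj v t + (-1) * X_adj (z v) t)"
  have m: "(\<lambda>t. (-1) * X_adj (z v) t) \<in> H10_space \<tau>" for v
    by (rule H10_space_scale[OF tau has_H10_adjointD(1)[OF X_adj]])
  have q: "q v \<in> H10_space \<tau>" for v
    unfolding q_def by (rule H10_space_add[OF tau has_H10_adjointD(1)[OF Xd_adj] m])
  have Tq: "T (q v) = T (Xd_adj v) - T (X_adj (z v))" if "H10_linear \<tau> T" for T :: "(real \<Rightarrow> real) \<Rightarrow> 'b::real_vector" and v
    unfolding q_def H10_linearD(1)[OF that has_H10_adjointD(1)[OF Xd_adj] m]
      H10_linearD(2)[OF that has_H10_adjointD(1)[OF X_adj]] by simp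
  have Xq: "X (q v) = 0" for v
  proof -
    have "X (X_adj (z v)) = W *v z v" by (simp add: matrix_H10_comp[OF X X_adj_linear])
    also have "\<dots> = N *v v"
      by (simp add: z_def matrix_vector_mul_assoc invertible_matrix_inv[OF inv] matrix_mul_assoc)
    finally show ?thesis by (simp add: Tq[OF X] matrix_H10_comp[OF X Xd_adj_linear])
  qed
  have Gq: "G *v v = Xd (q v)" for v
    by (simp add: Tq[OF Xd] z_def matrix_vector_mult_diff_rdistrib matrix_vector_mul_assoc[symmetric]
        matrix_H10_comp[OF Xd X_adj_linear] matrix_H10_comp[OF Xd Xd_adj_linear])
  have Gin: "(G *v v) \<bullet> w = H10_inner \<tau> (q v) (q w)" for v w
  proof -
    have "H10_inner \<tau> (q v) (q w) = H10_inner \<tau> (q v) (Xd_adj w) - H10_inner \<tau> (q v) (X_adj (z w))"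
      by (rule Tq[OF H10_linear_inner(2)[OF tau q]])
    then show ?thesis
      by (simp add: Gq has_H10_adjointD(2)[OF X_adj q] has_H10_adjointD(2)[OF Xd_adj q] Xq)
  qed
  have "\<exists>H :: real ^ 'n ^ 'n. G ** H = matrix (Xd \<circ> S) - F"
  proof (rule selfadjoint_matrix_factorization)
    show "(G *v v) \<bullet> w = v \<bullet> (G *v w)" for v w
      by (metis Gin H10_inner_commute inner_commute)
    fix v w assume "G *v v = 0"
    then have "H10_inner \<tau> (q v) (q v) = 0" using Gin[of v v] by simp
    then have "q v = (\<lambda>_. 0)" by (rule H10_inner_eq_0D[OF tau q])
    then have eq: "Xd_adj v = X_adj (z v)" by (auto simp: q_def fun_eq_iff)
    \<comment> \<open>For a kernel vector \<open>v\<close> of \<open>G\<close>, pairing with \<open>v\<close> makes \<open>X\<^sub>d\<close> depend on \<open>X\<close> alone, and \<open>X\<close> cannot tell two right inverses apart.\<close>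
    have key: "Xd \<phi> \<bullet> v = X \<phi> \<bullet> z v" if "\<phi> \<in> H10_space \<tau>" for \<phi>
      using has_H10_adjointD(2)[OF X_adj that, of "z v"] has_H10_adjointD(2)[OF Xd_adj that, of v] eq by simp
    have "Xd (S w) \<bullet> v = w \<bullet> z v"
      using key[OF H10_bounded_linearD(1)[OF Sl]] by (simp add: XS)
    moreover have "Xd (X_adj (Winv *v w)) \<bullet> v = (W *v (Winv *v w)) \<bullet> z v"
      using key[OF H10_bounded_linearD(1)[OF X_adj_linear]] by (simp add: matrix_H10_comp[OF X X_adj_linear])
    ultimately show "((matrix (Xd \<circ> S) - F) *v w) \<bullet> v = 0"
      by (simp add: matrix_vector_mult_diff_rdistrib inner_diff_left matrix_H10_comp[OF Xd Sl]
          matrix_H10_comp[OF Xd X_adj_linear] matrix_vector_mul_assoc[symmetric])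
         (simp add: matrix_vector_mul_assoc invertible_matrix_inv[OF inv])
  qed
  then show ?thesis by (metis add.commute diff_add_cancel)
qed

end

section \<open>Compatible systems and stabilizing feedback\<close>

text \<open>
  Compose \<open>X\<^sub>d = A X + B U\<close> with a right inverse of \<open>X\<close>. With the gain
  \<open>U S\<close>, all compatible systems have the same closed loop \<open>X\<^sub>d S\<close>.
\<close>
lemma closed_loop_eq:
  fixes x :: "real \<Rightarrow> real ^ 'n" and u :: "real \<Rightarrow> real ^ 'm"
  assumes "\<tau> > 0" and D: "(x, u) \<in> data_space \<tau>" and AB: "(A, B) \<in> compatible_systems \<tau> (x, u)"
    and S: "H10_right_inverse \<tau> (synthesis \<tau> x) S"
  shows "A + B ** matrix (synthesis \<tau> u \<circ> S) = matrix (diff_synthesis \<tau> x \<circ> S)"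
proof -
  have Sl: "H10_bounded_linear \<tau> S" and XS: "\<And>v. synthesis \<tau> x (S v) = v"
    using S by (auto simp: H10_right_inverse_def)
  have x: "x \<in> H1_space \<tau>" and u: "u \<in> L2_space \<tau>" using D by (auto simp: data_space_def)
  have xL: "x \<in> L2_space \<tau>"
    using continuous_on_imp_L2_space has_H1_deriv_continuous_on H1_space_has_H1_deriv[OF x] by blast
  show ?thesis
    unfolding matrix_eq
    by (simp add: matrix_H10_comp[OF H10_linear_diff_synthesis[OF assms(1) xL] Sl]
        diff_synthesis_eq_of_compatible[OF assms(1) D AB H10_bounded_linearD(1)[OF Sl]] XS
        matrix_vector_mult_add_rdistrib matrix_vector_mul_assoc[symmetric]
        matrix_H10_comp[OF H10_linear_synthesis[OF u] Sl])
qed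

text \<open>
  Suppose that \<open>(v, K v)\<close> is not a value of the pair \<open>(X, U)\<close>. Some \<open>(a, b)\<close>
  is then orthogonal to all values of the pair but not to \<open>(v, K v)\<close>. The first property means
  \<open>a \<bullet> x + b \<bullet> u = 0\<close> almost everywhere by the fundamental lemma, so adding rank-one
  matrices \<open>w a\<^sup>T\<close> and \<open>w b\<^sup>T\<close> to \<open>A\<close> and \<open>B\<close> leaves the system
  compatible for every \<open>w\<close>. The closed loop changes by
  \<open>w (a + K\<^sup>T b)\<^sup>T\<close> and stays Hurwitz, which forces \<open>a + K\<^sup>T b = 0\<close>. This
  contradicts the second property.
\<close>
lemma informative_imp_right_inverse:
  fixes x :: "real \<Rightarrow> real ^ 'n" and u :: "real \<Rightarrow> real ^ 'm" and K :: "real ^ 'n ^ 'm"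
  assumes "\<tau> > 0" and D: "(x, u) \<in> data_space \<tau>" and AB: "(A, B) \<in> compatible_systems \<tau> (x, u)"
    and stab: "\<And>A B. (A, B) \<in> compatible_systems \<tau> (x, u) \<Longrightarrow> hurwitz (A + B ** K)"
  shows "\<exists>S. H10_right_inverse \<tau> (synthesis \<tau> x) S \<and> matrix (synthesis \<tau> u \<circ> S) = K"
proof -
  have x: "x \<in> H1_space \<tau>" and u: "u \<in> L2_space \<tau>" using D by (auto simp: data_space_def)
  have xL: "x \<in> L2_space \<tau>"
    using continuous_on_imp_L2_space has_H1_deriv_continuous_on H1_space_has_H1_deriv[OF x] by blast
  note X = H10_linear_synthesis[OF xL] and U = H10_linear_synthesis[OF u]
  define T where "T = (\<lambda>\<phi>. (synthesis \<tau> x \<phi>, synthesis \<tau> u \<phi>))"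
  have T: "H10_linear \<tau> T"
    using X U by (auto simp: H10_linear_def T_def)
  define R where "R = T ` H10_space \<tau>"
  have R: "subspace R" unfolding R_def by (rule subspace_H10_linear_range[OF assms(1) T])
  have "(v, K *v v) \<in> R" for v
  proof -
    have "(v, K *v v) \<in> (R\<^sup>\<bottom>)\<^sup>\<bottom>"
      unfolding orthogonal_comp_def[of "R\<^sup>\<bottom>"]
    proof (safe)
      fix a b assume ab: "(a, b) \<in> R\<^sup>\<bottom>"
      define g where "g = (\<lambda>t. a \<bullet> x t + b \<bullet> u t)"
      have aL: "(\<lambda>t. a \<bullet> x t) \<in> L2_space \<tau>" and bL: "(\<lambda>t. b \<bullet> u t) \<in> L2_space \<tau>"
        using L2_space_bounded_linear[OF xL bounded_linear_inner_right] L2_space_bounded_linear[OF u bounded_linear_inner_right] .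
      have "AE t in lebesgue_on {0..\<tau>}. g t = 0"
      proof (rule AE_eq_0_if_orthogonal_to_H10_space[OF assms(1)])
        show "g \<in> L2_space \<tau>" unfolding g_def by (rule L2_space_add[OF aL bL])
        fix \<phi> assume p: "\<phi> \<in> H10_space \<tau>"
        have i: "integrable (lebesgue_on {0..\<tau>}) (\<lambda>t. \<phi> t *\<^sub>R x t)" "integrable (lebesgue_on {0..\<tau>}) (\<lambda>t. \<phi> t *\<^sub>R u t)"
          using p xL u by (auto intro: L2_space_scaleR_integrable H10_space_L2_space)
        have "orthogonal (T \<phi>) (a, b)" using ab p by (auto simp: orthogonal_comp_def R_def)
        then have "0 = a \<bullet> synthesis \<tau> x \<phi> + b \<bullet> synthesis \<tau> u \<phi>"
          by (simp add: orthogonal_def T_def inner_commute)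
        also have "\<dots> = (LINT t|lebesgue_on {0..\<tau>}. a \<bullet> (\<phi> t *\<^sub>R x t)) + (LINT t|lebesgue_on {0..\<tau>}. b \<bullet> (\<phi> t *\<^sub>R u t))"
          unfolding synthesis_def using i by (simp only: integral_inner_right)
        also have "\<dots> = (LINT t|lebesgue_on {0..\<tau>}. a \<bullet> (\<phi> t *\<^sub>R x t) + b \<bullet> (\<phi> t *\<^sub>R u t))"
          using i by (intro Bochner_Integration.integral_add[symmetric] integrable_inner_right)
        also have "\<dots> = (LINT t|lebesgue_on {0..\<tau>}. \<phi> t * g t)"
          by (simp add: g_def algebra_simps)
        finally show "(LINT t|lebesgue_on {0..\<tau>}. \<phi> t * g t) = 0" by simp
      qed
      then have g0: "AE t in lebesgue_on {0..\<tau>}. g t = 0" .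
      have "(A + rank_one w a, B + rank_one w b) \<in> compatible_systems \<tau> (x, u)" for w
      proof -
        have "AE t in lebesgue_on {0..\<tau>}. (x has_vector_derivative (A *v x t + B *v u t)) (at t within {0..\<tau>})"
          using AB by (simp add: compatible_systems_def)
        with g0 have "AE t in lebesgue_on {0..\<tau>}. (x has_vector_derivative
            ((A + rank_one w a) *v x t + (B + rank_one w b) *v u t)) (at t within {0..\<tau>})"
        proof eventually_elim
          case (elim t)
          have "(A + rank_one w a) *v x t + (B + rank_one w b) *v u t = A *v x t + B *v u t + g t *\<^sub>R w"
            by (simp add: g_def rank_one_mult_vec algebra_simps)
          with elim show ?case by simp
        qed
        then show ?thesis by (simp add: compatible_systems_def)
      qed
      then have hz: "hurwitz (A + rank_one w a + (B + rank_one w b) ** K)" for w by (rule stab)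
      have transpose: "(transpose K *v b) \<bullet> v = b \<bullet> (K *v v)" for v
        by (simp only: transpose_matrix_vector dot_lmul_matrix)
      have shift: "A + rank_one w a + (B + rank_one w b) ** K
          = (A + B ** K) + rank_one w (a + transpose K *v b)" for w
        unfolding matrix_eq
        by (simp only: matrix_vector_mult_add_rdistrib rank_one_mult_vec matrix_vector_mul_assoc[symmetric]
            inner_add_left scaleR_add_left transpose add.assoc add.left_commute simp_thms)
      have c: "a + transpose K *v b = 0"
        by (rule rank_one_perturbation_hurwitz_imp_0) (rule hz[unfolded shift])
      have "a \<bullet> v + b \<bullet> (K *v v) = (a + transpose K *v b) \<bullet> v"
        by (simp only: inner_add_left transpose)
      with c show "orthogonal (a, b) (v, K *v v)" by (simp add: orthogonal_def)
    qed
    then show ?thesis using orthogonal_comp_self[OF R] by simp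
  qed
  then have ex: "\<exists>\<phi>\<in>H10_space \<tau>. T \<phi> = (v, K *v v)" for v by (metis R_def imageE)
  have "linear (\<lambda>v. (v, K *v v))"
    by (intro linearI) (auto simp: matrix_vector_right_distrib matrix_vector_mult_scaleR)
  from H10_linear_lift[OF assms(1) T this ex]
  obtain S where S: "H10_bounded_linear \<tau> S" "\<And>v. T (S v) = (v, K *v v)" by blast
  then have "H10_right_inverse \<tau> (synthesis \<tau> x) S" by (simp add: H10_right_inverse_def T_def)
  moreover have "matrix (synthesis \<tau> u \<circ> S) = K"
    unfolding matrix_eq using S(2) by (simp add: matrix_H10_comp[OF U S(1)] T_def)
  ultimately show ?thesis by blast
qed

theorem theorem4p1:
  fixes \<tau> :: real
    and x :: "real \<Rightarrow> real ^ 'n" and u :: "real \<Rightarrow> real ^ 'm"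
    and As :: "real ^ 'n ^ 'n" and Bs :: "real ^ 'm ^ 'n"
    and Xd X :: "(real \<Rightarrow> real) \<Rightarrow> real ^ 'n" and U :: "(real \<Rightarrow> real) \<Rightarrow> real ^ 'm"
    and Xd_adj X_adj :: "real ^ 'n \<Rightarrow> (real \<Rightarrow> real)"
    and F G :: "real ^ 'n ^ 'n"
  assumes "\<tau> > 0"
    and "(x, u) \<in> data_space \<tau>"
    and "(As, Bs) \<in> compatible_systems \<tau> (x, u)"
    and "Xd = diff_synthesis \<tau> x" and "X = synthesis \<tau> x" and "U = synthesis \<tau> u"
    and "Xd_adj = H10_adjoint \<tau> Xd" and "X_adj = H10_adjoint \<tau> X"
    and "F = matrix (Xd \<circ> X_adj) ** matrix_inv (matrix (X \<circ> X_adj))"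
    and "G = matrix (Xd \<circ> Xd_adj)
             - matrix (Xd \<circ> X_adj) ** matrix_inv (matrix (X \<circ> X_adj)) ** matrix (X \<circ> Xd_adj)"
  shows "(informative_for_stabilization \<tau> (x, u) \<longleftrightarrow>
            X ` H10_space \<tau> = UNIV \<and> (\<exists>S. H10_right_inverse \<tau> X S \<and> hurwitz (matrix (Xd \<circ> S))))
       \<and> (informative_for_stabilization \<tau> (x, u) \<longleftrightarrow>
            invertible (matrix (X \<circ> X_adj)) \<and> (\<exists>H :: real ^ 'n ^ 'n. hurwitz (F + G ** H)))
       \<and> (\<forall>H :: real ^ 'n ^ 'n.
            invertible (matrix (X \<circ> X_adj)) \<and> hurwitz (F + G ** H) \<longrightarrow>
            (\<forall>(A, B) \<in> compatible_systems \<tau> (x, u).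
               hurwitz (A + B **
                 (matrix (U \<circ> X_adj) ** matrix_inv (matrix (X \<circ> X_adj))
                  + (matrix (U \<circ> Xd_adj)
                     - matrix (U \<circ> X_adj) ** matrix_inv (matrix (X \<circ> X_adj)) ** matrix (X \<circ> Xd_adj)) ** H))))"
proof -
  have x: "x \<in> H1_space \<tau>" and u: "u \<in> L2_space \<tau>" using assms(2) by (auto simp: data_space_def)
  have xc: "continuous_on {0..\<tau>} x"
    by (rule has_H1_deriv_continuous_on[OF H1_space_has_H1_deriv[OF x]])
  note xL = continuous_on_imp_L2_space[OF xc]
  have U: "H10_linear \<tau> U" unfolding assms(6) by (rule H10_linear_synthesis[OF u])
  interpret adjoint_pair \<tau> Xd X Xd_adj X_adj
    unfolding adjoint_pair_def assms(4,5,7,8)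
    by (intro conjI assms(1) H10_linear_synthesis[OF xL] H10_linear_diff_synthesis[OF assms(1) xL]
        has_H10_adjoint_synthesis[OF assms(1) xc] has_H10_adjoint_diff_synthesis[OF assms(1) xc])
  let ?K = "\<lambda>H. matrix (U \<circ> X_adj) ** Winv + (matrix (U \<circ> Xd_adj) - matrix (U \<circ> X_adj) ** Winv ** N) ** H"
  have gain: "hurwitz (A + B ** ?K H)"
    if "invertible W" "hurwitz (F + G ** H)" "(A, B) \<in> compatible_systems \<tau> (x, u)" for H A B
  proof -
    have "A + B ** matrix (U \<circ> lift H) = matrix (Xd \<circ> lift H)"
      using closed_loop_eq[OF assms(1,2) that(3)] lift_right_inverse[OF that(1)]
      unfolding assms(4,5,6) by blast
    then show ?thesis
      using that(2) unfolding assms(9,10) matrix_comp_lift[OF U] matrix_comp_lift[OF Xd] by simp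
  qed
  have i_ii: "X ` H10_space \<tau> = UNIV \<and> (\<exists>S. H10_right_inverse \<tau> X S \<and> hurwitz (matrix (Xd \<circ> S)))"
    if "informative_for_stabilization \<tau> (x, u)"
  proof -
    from that obtain K :: "real ^ 'n ^ 'm" where
      K: "\<And>A B. (A, B) \<in> compatible_systems \<tau> (x, u) \<Longrightarrow> hurwitz (A + B ** K)"
      unfolding informative_for_stabilization_def by blast
    from informative_imp_right_inverse[OF assms(1,2,3) K]
    obtain S where S: "H10_right_inverse \<tau> X S" "matrix (U \<circ> S) = K" unfolding assms(5,6) by blast
    have "hurwitz (matrix (Xd \<circ> S))"
      using K[OF assms(3)] closed_loop_eq[OF assms(1,2,3) S(1)[unfolded assms(5)]] S(2) unfolding assms(4,6) by simp
    moreover have "X ` H10_space \<tau> = UNIV"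
      using S(1) H10_bounded_linearD(1) unfolding H10_right_inverse_def by (metis UNIV_eq_I image_eqI)
    ultimately show ?thesis using S(1) by blast
  qed
  have ii_iii: "invertible W \<and> (\<exists>H :: real ^ 'n ^ 'n. hurwitz (F + G ** H))"
    if "X ` H10_space \<tau> = UNIV" "H10_right_inverse \<tau> X S" "hurwitz (matrix (Xd \<circ> S))" for S
    using gram_invertible_if_surj[OF that(1)] right_inverse_factorization[OF _ that(2)] that(3)
    unfolding assms(9,10) by metis
  have iii_i: "informative_for_stabilization \<tau> (x, u)" if "invertible W" "hurwitz (F + G ** H)" for H
    unfolding informative_for_stabilization_def using gain[OF that] by blast
  show ?thesis
    using i_ii ii_iii iii_i gain by blast
qed

end
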